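(* Let $G$ be a good bipartite graph with a fixed choice of non-standard monomials $z_1,\dots,z_p$ (in the sense defined in the context), let $R=K[x_1,\dots,x_n]/I(G)$ and let $\mathfrak m=\langle x_1,\dots,x_n\rangle$ be the maximal ideal of $R$ generated by the classes of the variables. Then for every integer $k\ge 0$, $\dim_K \mathfrak m^k/\mathfrak m^{k+1}=S_k$.
   Context: $K$ is a field and $G$ is a finite simple connected bipartite graph with vertex set $V(G)=\{1,\dots,m\}$ and $n\ge 1$ edges $e_1,\dots,e_n$. A variable $x_i$ is attached to each edge $e_i$. The toric ideal $I(G)\subset K[x_1,\dots,x_n]$ is the kernel of the $K$-algebra homomorphism $K[x_1,\dots,x_n]\to K[t_1,\dots,t_m]$ sending $x_i$ to $t_at_b$ when $e_i=\{a,b\}$. It is assumed that $I(G)$ is generated by quadratic binomials. Let $p$ be the number of 4-cycles of $G$ (as subgraphs). A 4-cycle with consecutive edges $(e_a,e_b,e_c,e_d)$ gives the binomial $x_ax_c-x_bx_d\in I(G)$. For the $i$-th 4-cycle, one of its two monomials $x_ax_c$, $x_bx_d$ is chosen and called $z_i$ (the non-standard one); the other is called $w_i$; put $f_i=w_i-z_i$, so that $I(G)=\langle f_1,\dots,f_p\rangle$. The graph $G$ (with $I(G)$ generated by quadratic binomials) is called good if these choices can be made so that: (a) the monomials $z_1,\dots,z_p$ are pairwise coprime; and (b) for every $t\ge 1$ and all indices $i_1,\dots,i_t\in\{1,\dots,p\}$ (not necessarily distinct), $\prod_{s=1}^t w_{i_s}\ne\prod_{s=1}^t z_{i_s}$ as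 monomials in $K[x_1,\dots,x_n]$. A choice satisfying (a) and (b) is fixed. $\mathcal M_k$ is the set of monomials of degree $k$ in $x_1,\dots,x_n$; $\mathcal S_k=\{\mu\in\mathcal M_k : z_i\nmid \mu \text{ for all } i=1,\dots,p\}$ is the set of standard monomials of degree $k$ (divisibility is in the polynomial ring $K[x_1,\dots,x_n]$); and $S_k=|\mathcal S_k|$. *)

theory Defs
  imports
    "HOL-Library.Poly_Mapping"
    "HOL-Algebra.QuotRing"
    "HOL-Algebra.Ideal_Product"
    "HOL-Algebra.Embedded_Algebras"
    "HOL-Algebra.Algebraic_Closure_Type"
begin

section \<open>Polynomial rings\<close>

text \<open>
  For a finite type \<open>'x\<close>, the type \<open>('x, 'k) mpoly\<close> is the polynomial ring over \<open>'k\<close> in the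
  variables \<open>x\<^sub>i\<close>, \<open>i :: 'x\<close>: a polynomial is a finitely supported function from exponent
  vectors to coefficients, and multiplication is convolution.
\<close>

type_synonym ('x, 'k) mpoly = "('x \<Rightarrow>\<^sub>0 nat) \<Rightarrow>\<^sub>0 'k"

definition const :: "'k::field \<Rightarrow> ('x::finite, 'k) mpoly" where
  "const c = Poly_Mapping.single 0 c"

definition mon :: "('x::finite \<Rightarrow>\<^sub>0 nat) \<Rightarrow> ('x, 'k::field) mpoly" where
  "mon \<mu> = Poly_Mapping.single \<mu> 1"

definition var :: "'x::finite \<Rightarrow> ('x, 'k::field) mpoly" where
  "var i = mon (Poly_Mapping.single i 1)"

definition total_deg :: "('x::finite \<Rightarrow>\<^sub>0 nat) \<Rightarrow> nat" where
  "total_deg \<mu> = (\<Sum>i\<in>UNIV. Poly_Mapping.lookup \<mu> i)"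

definition monomials :: "nat \<Rightarrow> ('x::finite, 'k::field) mpoly set" where
  "monomials k = {mon \<mu> | \<mu>. total_deg \<mu> = k}"

definition quadratic_binomials :: "('x::finite, 'k::field) mpoly set" where
  "quadratic_binomials = {u - v | u v. u \<in> monomials 2 \<and> v \<in> monomials 2 \<and> u \<noteq> v}"

abbreviation poly_ring :: "('x::finite, 'k::field) mpoly ring" where
  "poly_ring \<equiv> ring_of_type_algebra"

section \<open>Graphs\<close>

text \<open>
  A graph is given by its family of edges: the vertices are the elements of the finite type
  \<open>'v\<close>, the edges are indexed by the (nonempty) finite type \<open>'n\<close>, and \<open>e i\<close> is the set of
  endpoints of the \<open>i\<close>-th edge.
\<close>

definition simple_graph :: "('n::finite \<Rightarrow> 'v::finite set) \<Rightarrow> bool" where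
  "simple_graph e \<longleftrightarrow> inj e \<and> (\<forall>i. card (e i) = 2)"

definition connected_graph :: "('n::finite \<Rightarrow> 'v::finite set) \<Rightarrow> bool" where
  "connected_graph e \<longleftrightarrow> (\<forall>u v. (\<lambda>a b. \<exists>i. e i = {a, b})\<^sup>*\<^sup>* u v)"

definition bipartite_graph :: "('n::finite \<Rightarrow> 'v::finite set) \<Rightarrow> bool" where
  "bipartite_graph e \<longleftrightarrow>
     (\<exists>A B. A \<union> B = UNIV \<and> A \<inter> B = {} \<and> (\<forall>i. \<exists>a\<in>A. \<exists>b\<in>B. e i = {a, b}))"

definition consecutive_4cycle ::
  "('n::finite \<Rightarrow> 'v::finite set) \<Rightarrow> 'n \<Rightarrow> 'n \<Rightarrow> 'n \<Rightarrow> 'n \<Rightarrow> bool" where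
  "consecutive_4cycle e a b c d \<longleftrightarrow>
     (\<exists>v1 v2 v3 v4. distinct [v1, v2, v3, v4] \<and>
        e a = {v1, v2} \<and> e b = {v2, v3} \<and> e c = {v3, v4} \<and> e d = {v4, v1})"

text \<open>A 4-cycle, as a subgraph, is determined by its set of edges.\<close>

definition four_cycles :: "('n::finite \<Rightarrow> 'v::finite set) \<Rightarrow> 'n set set" where
  "four_cycles e = {{a, b, c, d} | a b c d. consecutive_4cycle e a b c d}"

section \<open>The toric ideal and good graphs\<close>

text \<open>
  The algebra homomorphism \<open>K[x] \<rightarrow> K[t]\<close> with \<open>x\<^sub>i \<mapsto> t\<^sub>a t\<^sub>b\<close> for \<open>e i = {a, b}\<close>.
\<close>

definition toric_map ::
  "('n::finite \<Rightarrow> 'v::finite set) \<Rightarrow> ('n, 'k::field) mpoly \<Rightarrow> ('v, 'k) mpoly" where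
  "toric_map e p =
     (\<Sum>\<mu>\<in>Poly_Mapping.keys p.
        const (Poly_Mapping.lookup p \<mu>) *
        (\<Prod>i\<in>UNIV. (\<Prod>v\<in>e i. var v) ^ Poly_Mapping.lookup \<mu> i))"

definition toric_ideal :: "('n::finite \<Rightarrow> 'v::finite set) \<Rightarrow> ('n, 'k::field) mpoly set" where
  "toric_ideal e = a_kernel poly_ring (poly_ring :: ('v, 'k) mpoly ring) (toric_map e)"

definition generated_by_quadratic_binomials :: "('n::finite, 'k::field) mpoly set \<Rightarrow> bool" where
  "generated_by_quadratic_binomials I \<longleftrightarrow>
     (\<exists>B \<subseteq> quadratic_binomials. I = genideal poly_ring B)"

text \<open>
  The chosen monomials are indexed by the 4-cycles themselves: \<open>z C\<close> is the non-standard
  monomial of the 4-cycle \<open>C\<close>, and \<open>w C\<close> is the other monomial. Since the edges of \<open>C\<close> can be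
  listed starting from any of them, either of the two monomials of \<open>C\<close> can be \<open>z C\<close>.
\<close>

definition nonstandard_choice ::
  "('n::finite \<Rightarrow> 'v::finite set) \<Rightarrow> ('n set \<Rightarrow> ('n, 'k::field) mpoly) \<Rightarrow>
     ('n set \<Rightarrow> ('n, 'k) mpoly) \<Rightarrow> bool" where
  "nonstandard_choice e z w \<longleftrightarrow>
     (\<forall>C\<in>four_cycles e. \<exists>a b c d. consecutive_4cycle e a b c d \<and> C = {a, b, c, d} \<and>
        z C = var a * var c \<and> w C = var b * var d)"

text \<open>Coprimality is spelled out because \<^const>\<open>coprime\<close> is not available on this type.\<close>

definition good_choice ::
  "('n::finite \<Rightarrow> 'v::finite set) \<Rightarrow> ('n set \<Rightarrow> ('n, 'k::field) mpoly) \<Rightarrow>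
     ('n set \<Rightarrow> ('n, 'k) mpoly) \<Rightarrow> bool" where
  "good_choice e z w \<longleftrightarrow>
     nonstandard_choice e z w \<and>
     (\<forall>C\<in>four_cycles e. \<forall>D\<in>four_cycles e. C \<noteq> D \<longrightarrow>
        (\<forall>q. q dvd z C \<and> q dvd z D \<longrightarrow> q dvd 1)) \<and>
     (\<forall>Cs. Cs \<noteq> [] \<and> set Cs \<subseteq> four_cycles e \<longrightarrow>
        prod_list (map w Cs) \<noteq> prod_list (map z Cs))"

definition standard_monomials ::
  "('n::finite \<Rightarrow> 'v::finite set) \<Rightarrow> ('n set \<Rightarrow> ('n, 'k::field) mpoly) \<Rightarrow>
     nat \<Rightarrow> ('n, 'k) mpoly set" where
  "standard_monomials e z k = {\<mu> \<in> monomials k. \<forall>C\<in>four_cycles e. \<not> z C dvd \<mu>}"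

section \<open>The quotient ring and the powers of its maximal ideal\<close>

definition toric_ring ::
  "('n::finite \<Rightarrow> 'v::finite set) \<Rightarrow> ('n, 'k::field) mpoly set ring" where
  "toric_ring e = poly_ring Quot toric_ideal e"

definition residue_class ::
  "('n::finite \<Rightarrow> 'v::finite set) \<Rightarrow> ('n, 'k::field) mpoly \<Rightarrow> ('n, 'k) mpoly set" where
  "residue_class e p = toric_ideal e +>\<^bsub>poly_ring\<^esub> p"

definition max_ideal ::
  "('n::finite \<Rightarrow> 'v::finite set) \<Rightarrow> ('n, 'k::field) mpoly set set" where
  "max_ideal e = genideal (toric_ring e) (range (\<lambda>i. residue_class e (var i)))"

definition max_ideal_pow ::
  "('n::finite \<Rightarrow> 'v::finite set) \<Rightarrow> nat \<Rightarrow> ('n, 'k::field) mpoly set set" where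
  "max_ideal_pow e k = max_ideal e [^]\<^bsub>ideals_set (toric_ring e)\<^esub> k"

text \<open>
  Write \<open>R\<close> for the quotient ring and \<open>m\<close> for its maximal ideal. The quotient \<open>m\<^sup>k / m\<^sup>k\<^sup>+\<^sup>1\<close> is
  the set of cosets of elements of \<open>m\<^sup>k\<close>, a subset of the ring \<open>R / m\<^sup>k\<^sup>+\<^sup>1\<close>. Its scalar
  multiplication by \<open>c\<close> is multiplication by the class of the constant polynomial \<open>c\<close>, so its
  dimension over \<open>K\<close> is the dimension over the copy of \<open>K\<close> in \<open>R / m\<^sup>k\<^sup>+\<^sup>1\<close> formed by the
  classes of the constants.
\<close>

definition truncated_ring ::
  "('n::finite \<Rightarrow> 'v::finite set) \<Rightarrow> nat \<Rightarrow> ('n, 'k::field) mpoly set set ring" where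
  "truncated_ring e k = toric_ring e Quot max_ideal_pow e (Suc k)"

definition scalars ::
  "('n::finite \<Rightarrow> 'v::finite set) \<Rightarrow> nat \<Rightarrow> ('n, 'k::field) mpoly set set set" where
  "scalars e k =
     range (\<lambda>c. max_ideal_pow e (Suc k) +>\<^bsub>toric_ring e\<^esub> residue_class e (const c))"

definition power_quotient ::
  "('n::finite \<Rightarrow> 'v::finite set) \<Rightarrow> nat \<Rightarrow> ('n, 'k::field) mpoly set set set" where
  "power_quotient e k =
     (\<lambda>a. max_ideal_pow e (Suc k) +>\<^bsub>toric_ring e\<^esub> a) ` max_ideal_pow e k"

end

(* An ideal of the polynomial ring is handled through the linear functionals that vanish on it:
   the toric ideal is cut out by all functionals on monomials that only depend on the toric
   image of the monomial. It is therefore enough to see that the standard monomials represent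
   each toric image exactly once. Rewriting z_i to w_i terminates by condition (b), so every
   monomial has the toric image of a standard one. By condition (a) two different rewriting
   steps commute, so the rewriting is confluent; since the ideal is generated by quadratic
   binomials, and each of these is a single step given by a 4-cycle, monomials with the same
   toric image are connected by steps and hence have the same standard form. *)

theory Submission
  imports Defs "HOL-Library.Confluence"
begin

text \<open>Every separation of classes is shown by evaluating a functional that is the 0/1
  indicator of a set of monomials, so the argument works over any field and needs no normal forms of
  polynomials. Powers of m enter through one count: each edge has two endpoints, so monomials with
  equal toric image have equal degree. Hence the indicator of a toric fibre of degree
  \<open>k\<close> kills the toric ideal and all polynomials with terms only in degrees above
  \<open>k\<close>, and descends to R/m^(k+1). On the standard monomials of degree \<open>k\<close>
  these indicators are a dual basis, which gives independence; they span because a monomial may be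
  exchanged for the standard one in its fibre. Condition (b) speaks of products, not of rewriting:
  along a cycle of steps the cofactors cancel and leave an equality of a product of w's with a
  product of z's. Termination follows from the absence of cycles because steps preserve the degree
  and each degree has finitely many monomials.\<close>

abbreviation (input) lookup where "lookup \<equiv> Poly_Mapping.lookup"
abbreviation (input) keys where "keys \<equiv> Poly_Mapping.keys"

section \<open>Monomials and exponent vectors\<close>

lemma poly_mapping_eq_sum_single: "p = (\<Sum>\<mu>\<in>keys p. Poly_Mapping.single \<mu> (lookup p \<mu>))"
proof (rule poly_mapping_eqI)
  fix \<nu>
  show "lookup p \<nu> = lookup (\<Sum>\<mu>\<in>keys p. Poly_Mapping.single \<mu> (lookup p \<mu>)) \<nu>"
    by (auto simp: lookup_sum lookup_single when_def sum.delta' in_keys_iff)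
qed

lemma mon_add: "mon (\<mu> + \<nu>) = mon \<mu> * mon \<nu>"
  by (simp add: mon_def mult_single)

lemma mon_0: "mon 0 = 1"
  by (simp add: mon_def)

lemma mon_eq_iff [simp]: "(mon \<mu> :: ('x::finite, 'k::field) mpoly) = mon \<nu> \<longleftrightarrow> \<mu> = \<nu>"
proof
  assume "(mon \<mu> :: ('x, 'k) mpoly) = mon \<nu>"
  then have "keys (mon \<mu> :: ('x, 'k) mpoly) = keys (mon \<nu> :: ('x, 'k) mpoly)" by simp
  then show "\<mu> = \<nu>" by (simp add: mon_def)
qed simp

lemma prod_mon: "(\<Prod>i\<in>A. mon (f i)) = mon (\<Sum>i\<in>A. f i)"
  by (induction A rule: infinite_finite_induct) (simp_all add: mon_0 mon_add)

lemma prod_list_mon: "prod_list (map (\<lambda>x. mon (f x)) xs) = mon (sum_list (map f xs))"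
  by (induction xs) (simp_all add: mon_0 mon_add)

lemma const_mult_mon: "const c * mon \<mu> = Poly_Mapping.single \<mu> c"
  by (simp add: const_def mon_def mult_single)

text \<open>The cofactor may be any polynomial, but each exponent in the support of the product is
  \<open>\<mu>\<close> plus an exponent of the cofactor, and \<open>\<nu>\<close> is in that
  support.\<close>

lemma mon_dvd_mon_iff:
  "(mon \<mu> :: ('x::finite, 'k::field) mpoly) dvd mon \<nu> \<longleftrightarrow> (\<exists>\<delta>. \<nu> = \<mu> + \<delta>)"
proof
  assume "(mon \<mu> :: ('x, 'k) mpoly) dvd mon \<nu>"
  then obtain q :: "('x, 'k) mpoly" where "mon \<nu> = mon \<mu> * q" by (elim dvdE)
  moreover have "\<nu> \<in> keys (mon \<nu> :: ('x, 'k) mpoly)" by (simp add: mon_def)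
  ultimately have "\<nu> \<in> keys (mon \<mu> * q)" by simp
  then show "\<exists>\<delta>. \<nu> = \<mu> + \<delta>"
    using keys_mult[of "mon \<mu>" q] by (auto simp: mon_def)
qed (auto simp: mon_add)

lemma total_deg_add: "total_deg (\<mu> + \<nu>) = total_deg \<mu> + total_deg \<nu>"
  by (simp add: total_deg_def lookup_add sum.distrib)

lemma total_deg_single [simp]: "total_deg (Poly_Mapping.single i n) = n"
  by (simp add: total_deg_def lookup_single when_def)

lemma exponent_eq_single_add:
  assumes "0 < lookup \<mu> i"
  shows "\<exists>\<nu>. \<mu> = \<nu> + Poly_Mapping.single i (1::nat)"
proof
  show "\<mu> = (\<mu> - Poly_Mapping.single i 1) + Poly_Mapping.single i 1"
    using assms by (intro poly_mapping_eqI) (auto simp: lookup_add lookup_minus lookup_single when_def)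
qed

lemma total_deg_SucE:
  assumes "total_deg \<mu> = Suc n"
  obtains \<nu> i where "\<mu> = \<nu> + Poly_Mapping.single i 1" "total_deg \<nu> = n"
proof -
  have "\<exists>i. 0 < lookup \<mu> i"
  proof (rule ccontr)
    assume "\<nexists>i. 0 < lookup \<mu> i"
    then have "total_deg \<mu> = 0" by (simp add: total_deg_def)
    with assms show False by simp
  qed
  then obtain i where "0 < lookup \<mu> i" ..
  then obtain \<nu> where eq: "\<mu> = \<nu> + Poly_Mapping.single i 1"
    by (blast dest: exponent_eq_single_add)
  with assms have "total_deg \<nu> = n" by (simp add: total_deg_add)
  with eq show thesis by (rule that)
qed

lemma finite_total_deg: "finite {\<mu> :: 'x::finite \<Rightarrow>\<^sub>0 nat. total_deg \<mu> = n}"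
proof -
  have "lookup ` {\<mu> :: 'x \<Rightarrow>\<^sub>0 nat. total_deg \<mu> = n} \<subseteq> Pi\<^sub>E UNIV (\<lambda>_. {..n})"
    by (auto simp: PiE_def Pi_def total_deg_def intro: member_le_sum)
  then have "finite (lookup ` {\<mu> :: 'x \<Rightarrow>\<^sub>0 nat. total_deg \<mu> = n})"
    by (rule finite_subset) (intro finite_PiE; simp)
  then show ?thesis
    by (rule finite_imageD) (simp add: inj_on_def poly_mapping.lookup_inject)
qed

section \<open>The polynomial ring as a ring with explicit carrier\<close>

lemma poly_ring_simps [simp]:
  "carrier poly_ring = UNIV" "x \<oplus>\<^bsub>poly_ring\<^esub> y = x + y" "x \<otimes>\<^bsub>poly_ring\<^esub> y = x * y"
  "\<zero>\<^bsub>poly_ring\<^esub> = 0" "\<one>\<^bsub>poly_ring\<^esub> = 1"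
  by (simp_all add: ring_of_type_algebra_def)

lemma a_inv_poly_ring [simp]:
  fixes x :: "('x::finite, 'k::field) mpoly"
  shows "\<ominus>\<^bsub>poly_ring\<^esub> x = - x"
proof -
  interpret cring "poly_ring :: ('x, 'k) mpoly ring" by (rule cring_from_type_algebra)
  show ?thesis by (rule minus_equality) simp_all
qed

lemma a_minus_poly_ring [simp]:
  fixes x :: "('x::finite, 'k::field) mpoly"
  shows "x \<ominus>\<^bsub>poly_ring\<^esub> y = x - y"
  by (simp add: a_minus_def)

lemma ideal_poly_ringI:
  fixes I :: "('x::finite, 'k::field) mpoly set"
  assumes "0 \<in> I" "\<And>p q. p \<in> I \<Longrightarrow> q \<in> I \<Longrightarrow> p + q \<in> I" "\<And>r p. p \<in> I \<Longrightarrow> r * p \<in> I"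
  shows "ideal I poly_ring"
proof -
  interpret cring "poly_ring :: ('x, 'k) mpoly ring" by (rule cring_from_type_algebra)
  have neg: "- p \<in> I" if "p \<in> I" for p using assms(3)[OF that, of "-1"] by simp
  show ?thesis
  proof (rule idealI)
    show "subgroup I (add_monoid poly_ring)"
      using assms neg by (intro add.subgroupI) (auto simp flip: a_inv_def)
  qed (use assms ring_axioms in \<open>auto simp: mult.commute\<close>)
qed

section \<open>Linear functionals, given by their values on monomials, and the ideals they cut
  out\<close>

definition pairing :: "(('x::finite \<Rightarrow>\<^sub>0 nat) \<Rightarrow> 'k) \<Rightarrow> ('x, 'k::field) mpoly \<Rightarrow> 'k" where
  "pairing f p = (\<Sum>\<mu>\<in>keys p. lookup p \<mu> * f \<mu>)"

lemma pairing_superset: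
  assumes "finite A" "keys p \<subseteq> A"
  shows "pairing f p = (\<Sum>\<mu>\<in>A. lookup p \<mu> * f \<mu>)"
  unfolding pairing_def using assms by (intro sum.mono_neutral_left) (auto simp: in_keys_iff)

lemma pairing_add: "pairing f (p + q) = pairing f p + pairing f q"
proof -
  have "pairing f r = (\<Sum>\<mu>\<in>keys p \<union> keys q. lookup r \<mu> * f \<mu>)" if "r \<in> {p, q, p + q}" for r
    using that keys_add[of p q] by (intro pairing_superset) auto
  then show ?thesis by (simp add: lookup_add sum.distrib distrib_right)
qed

lemma pairing_0 [simp]: "pairing f 0 = 0"
  by (simp add: pairing_def)

lemma pairing_single: "pairing f (Poly_Mapping.single \<mu> c) = c * f \<mu>"
  by (simp add: pairing_def)

lemma pairing_mon: "pairing f (mon \<mu>) = f \<mu>"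
  by (simp add: mon_def pairing_single)

lemma pairing_sum: "pairing f (sum g A) = (\<Sum>x\<in>A. pairing f (g x))"
  by (induction A rule: infinite_finite_induct) (simp_all add: pairing_add)

lemma pairing_uminus: "pairing f (- p) = - pairing f p"
  using pairing_add[of f p "- p"] by (simp add: eq_neg_iff_add_eq_0 add.commute)

lemma pairing_diff: "pairing f (p - q) = pairing f p - pairing f q"
  using pairing_add[of f p "- q"] by (simp add: pairing_uminus)

text \<open>Multiplication by a monomial is adjoint to shifting the functional. An annihilator is
  therefore closed under multiplication as soon as its set of functionals is closed under
  shifts.\<close>

lemma pairing_mult:
  "pairing f (q * p) = (\<Sum>\<delta>\<in>keys q. lookup q \<delta> * pairing (\<lambda>\<mu>. f (\<delta> + \<mu>)) p)"
proof -
  have "q * p = (\<Sum>\<delta>\<in>keys q. \<Sum>\<mu>\<in>keys p. Poly_Mapping.single (\<delta> + \<mu>) (lookup q \<delta> * lookup p \<mu>))"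
    by (subst poly_mapping_eq_sum_single[of q], subst poly_mapping_eq_sum_single[of p])
      (simp only: sum_product mult_single)
  then have "pairing f (q * p)
      = (\<Sum>\<delta>\<in>keys q. \<Sum>\<mu>\<in>keys p. lookup q \<delta> * lookup p \<mu> * f (\<delta> + \<mu>))"
    by (simp add: pairing_sum pairing_single)
  then show ?thesis by (simp add: pairing_def sum_distrib_left mult.assoc)
qed

definition annihilator :: "(('x::finite \<Rightarrow>\<^sub>0 nat) \<Rightarrow> 'k) set \<Rightarrow> ('x, 'k::field) mpoly set" where
  "annihilator F = {p. \<forall>f\<in>F. pairing f p = 0}"

lemma mon_diff_mem_annihilator_iff: "mon \<mu> - mon \<nu> \<in> annihilator F \<longleftrightarrow> (\<forall>f\<in>F. f \<mu> = f \<nu>)"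
  by (simp add: annihilator_def pairing_diff pairing_mon)

lemma ideal_annihilator:
  assumes "\<And>f \<delta>. f \<in> F \<Longrightarrow> (\<lambda>\<mu>. f (\<delta> + \<mu>)) \<in> F"
  shows "ideal (annihilator F) poly_ring"
  by (rule ideal_poly_ringI) (use assms in \<open>auto simp: annihilator_def pairing_add pairing_mult\<close>)

section \<open>The toric ideal\<close>

text \<open>The vertex-edge incidence matrix applied to \<open>\<mu>\<close>: the exponent of the
  monomial to which the toric map sends \<open>mon \<mu>\<close>.\<close>

definition toric_exponent :: "('n::finite \<Rightarrow> 'v::finite set) \<Rightarrow> ('n \<Rightarrow>\<^sub>0 nat) \<Rightarrow> 'v \<Rightarrow>\<^sub>0 nat" where
  "toric_exponent e \<mu> = (\<Sum>i\<in>UNIV. \<Sum>v\<in>e i. Poly_Mapping.single v (lookup \<mu> i))"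

lemma lookup_toric_exponent: "lookup (toric_exponent e \<mu>) v = (\<Sum>i\<in>UNIV. if v \<in> e i then lookup \<mu> i else 0)"
  by (auto simp: toric_exponent_def lookup_sum lookup_single when_def intro!: sum.cong)

lemma toric_exponent_add: "toric_exponent e (\<mu> + \<nu>) = toric_exponent e \<mu> + toric_exponent e \<nu>"
  by (simp add: toric_exponent_def lookup_add single_add sum.distrib)

lemma toric_exponent_shift:
  "toric_exponent e \<mu> = toric_exponent e \<nu> \<Longrightarrow> toric_exponent e (\<delta> + \<mu>) = toric_exponent e (\<delta> + \<nu>)"
  by (simp add: toric_exponent_add)

text \<open>Double counting of incidences. It confines each fibre of \<open>toric_exponent\<close>
  to one degree, so the toric ideal respects the grading.\<close>

lemma total_deg_toric_exponent:
  assumes "simple_graph e"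
  shows "total_deg (toric_exponent e \<mu>) = 2 * total_deg \<mu>"
proof -
  have "total_deg (toric_exponent e \<mu>) = (\<Sum>i\<in>UNIV. \<Sum>v\<in>UNIV. if v \<in> e i then lookup \<mu> i else 0)"
    unfolding total_deg_def lookup_toric_exponent by (rule sum.swap)
  also have "\<dots> = (\<Sum>i\<in>UNIV. 2 * lookup \<mu> i)"
    using assms by (intro sum.cong refl) (simp add: simple_graph_def sum.If_cases)
  finally show ?thesis by (simp add: total_deg_def sum_distrib_left)
qed

lemma mon_single_power: "mon (Poly_Mapping.single v 1) ^ n = mon (Poly_Mapping.single v n)"
proof (induction n)
  case (Suc n)
  then show ?case by (simp only: power_Suc mon_add[symmetric] single_add[symmetric] plus_1_eq_Suc)
qed (simp add: mon_0)

text \<open>Monomials go to monomials, so a coefficient of the image collects the coefficients over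
  one fibre, which is a pairing with the indicator of that fibre.\<close>

lemma lookup_toric_map:
  fixes e :: "'n::finite \<Rightarrow> 'v::finite set" and p :: "('n, 'k::field) mpoly"
  shows "lookup (toric_map e p) \<nu> = pairing (\<lambda>\<mu>. of_bool (toric_exponent e \<mu> = \<nu>)) p"
proof -
  have "(\<Prod>v\<in>e i. var v :: ('v, 'k) mpoly) ^ n = mon (\<Sum>v\<in>e i. Poly_Mapping.single v n)" for i n
    unfolding prod_power_distrib var_def mon_single_power by (rule prod_mon)
  then have "(\<Prod>i\<in>UNIV. (\<Prod>v\<in>e i. var v) ^ lookup \<mu> i) = (mon (toric_exponent e \<mu>) :: ('v, 'k) mpoly)" for \<mu>
    by (simp add: prod_mon toric_exponent_def)
  then have "toric_map e p = (\<Sum>\<mu>\<in>keys p. Poly_Mapping.single (toric_exponent e \<mu>) (lookup p \<mu>))"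
    by (simp add: toric_map_def const_mult_mon)
  then have "lookup (toric_map e p) \<nu> = (\<Sum>\<mu>\<in>keys p. lookup p \<mu> when toric_exponent e \<mu> = \<nu>)"
    by (simp add: lookup_sum lookup_single)
  also have "\<dots> = pairing (\<lambda>\<mu>. of_bool (toric_exponent e \<mu> = \<nu>)) p"
    unfolding pairing_def by (intro sum.cong refl) (simp add: when_def)
  finally show ?thesis .
qed

text \<open>On the finite support of \<open>p\<close>, a function constant on fibres is a
  combination of fibre indicators, and these vanish on the kernel by
  \<open>lookup_toric_map\<close>. Conversely the indicators are themselves constant on fibres, and
  together they detect every coefficient of the image.\<close>

lemma toric_ideal_eq_annihilator:
  "(toric_ideal e :: ('n::finite, 'k::field) mpoly set) = annihilator {f. \<forall>\<mu> \<nu>. toric_exponent e \<mu> = toric_exponent e \<nu> \<longrightarrow> f \<mu> = f \<nu>}"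
    (is "_ = annihilator ?F")
proof (intro equalityI subsetI)
  fix p :: "('n, 'k) mpoly" assume "p \<in> toric_ideal e"
  then have "toric_map e p = 0" by (simp add: toric_ideal_def a_kernel_def')
  then have fibre: "pairing (\<lambda>\<mu>. of_bool (toric_exponent e \<mu> = \<nu>)) p = 0" for \<nu>
    unfolding lookup_toric_map[symmetric] by simp
  have "pairing f p = 0" if f: "f \<in> ?F" for f
  proof -
    have "pairing f p
        = (\<Sum>\<nu>\<in>toric_exponent e ` keys p. \<Sum>\<mu>\<in>{\<mu>\<in>keys p. toric_exponent e \<mu> = \<nu>}. lookup p \<mu> * f \<mu>)"
      unfolding pairing_def by (rule sum.image_gen) simp
    also have "\<dots> = 0"
    proof (rule sum.neutral, rule ballI)
      fix \<nu> assume "\<nu> \<in> toric_exponent e ` keys p"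
      then obtain \<mu>\<^sub>0 where "\<nu> = toric_exponent e \<mu>\<^sub>0" by blast
      with f have "f \<mu> = f \<mu>\<^sub>0" if "toric_exponent e \<mu> = \<nu>" for \<mu>
        using that by blast
      then have "(\<Sum>\<mu>\<in>{\<mu>\<in>keys p. toric_exponent e \<mu> = \<nu>}. lookup p \<mu> * f \<mu>)
          = (\<Sum>\<mu>\<in>{\<mu>\<in>keys p. toric_exponent e \<mu> = \<nu>}. lookup p \<mu>) * f \<mu>\<^sub>0"
        unfolding sum_distrib_right by (intro sum.cong refl) simp
      also have "(\<Sum>\<mu>\<in>{\<mu>\<in>keys p. toric_exponent e \<mu> = \<nu>}. lookup p \<mu>)
          = pairing (\<lambda>\<mu>. of_bool (toric_exponent e \<mu> = \<nu>)) p"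
      proof -
        have "pairing (\<lambda>\<mu>. of_bool (toric_exponent e \<mu> = \<nu>)) p
            = (\<Sum>\<mu>\<in>keys p. if toric_exponent e \<mu> = \<nu> then lookup p \<mu> else 0)"
          unfolding pairing_def by (intro sum.cong refl) simp
        then show ?thesis by (simp only: sum.inter_filter[OF finite_keys])
      qed
      also note fibre[of \<nu>]
      finally show "(\<Sum>\<mu>\<in>{\<mu>\<in>keys p. toric_exponent e \<mu> = \<nu>}. lookup p \<mu> * f \<mu>) = 0" by simp
    qed
    finally show ?thesis .
  qed
  then show "p \<in> annihilator ?F" unfolding annihilator_def by (intro CollectI ballI)
next
  fix p :: "('n, 'k) mpoly" assume "p \<in> annihilator ?F"
  moreover have "(\<lambda>\<mu>. of_bool (toric_exponent e \<mu> = \<nu>)) \<in> ?F" for \<nu> by simp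
  ultimately have "lookup (toric_map e p) \<nu> = 0" for \<nu>
    unfolding lookup_toric_map annihilator_def by blast
  then have "toric_map e p = 0" by (intro poly_mapping_eqI) simp
  then show "p \<in> toric_ideal e" by (simp add: toric_ideal_def a_kernel_def')
qed

lemma ideal_toric_ideal: "ideal (toric_ideal e :: ('n::finite, 'k::field) mpoly set) poly_ring"
  unfolding toric_ideal_eq_annihilator
proof (rule ideal_annihilator)
  fix f :: "_ \<Rightarrow> 'k" and \<delta>
  assume f: "f \<in> {f. \<forall>\<mu> \<nu>. toric_exponent e \<mu> = toric_exponent e \<nu> \<longrightarrow> f \<mu> = f \<nu>}"
  show "(\<lambda>\<mu>. f (\<delta> + \<mu>)) \<in> {f. \<forall>\<mu> \<nu>. toric_exponent e \<mu> = toric_exponent e \<nu> \<longrightarrow> f \<mu> = f \<nu>}"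
  proof (rule CollectI, intro allI impI)
    fix \<mu> \<nu> assume "toric_exponent e \<mu> = toric_exponent e \<nu>"
    then have "toric_exponent e (\<delta> + \<mu>) = toric_exponent e (\<delta> + \<nu>)" by (rule toric_exponent_shift)
    with f show "f (\<delta> + \<mu>) = f (\<delta> + \<nu>)" by blast
  qed
qed

lemma mon_diff_mem_toric_ideal_iff:
  "(mon \<mu> - mon \<nu> :: ('n::finite, 'k::field) mpoly) \<in> toric_ideal e \<longleftrightarrow> toric_exponent e \<mu> = toric_exponent e \<nu>"
proof
  let ?f = "\<lambda>\<alpha>. of_bool (toric_exponent e \<alpha> = toric_exponent e \<mu>) :: 'k"
  assume "(mon \<mu> - mon \<nu> :: ('n, 'k) mpoly) \<in> toric_ideal e"
  then have "?f \<mu> = ?f \<nu>"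
    unfolding toric_ideal_eq_annihilator mon_diff_mem_annihilator_iff by (rule bspec) simp
  then show "toric_exponent e \<mu> = toric_exponent e \<nu>" by (simp split: if_splits)
next
  assume "toric_exponent e \<mu> = toric_exponent e \<nu>"
  then show "(mon \<mu> - mon \<nu> :: ('n, 'k) mpoly) \<in> toric_ideal e"
    unfolding toric_ideal_eq_annihilator mon_diff_mem_annihilator_iff by blast
qed

section \<open>Reduction to standard monomials\<close>

text \<open>With exponent vectors, divisibility is the existence of an additive cofactor
  \<open>\<delta>\<close>. The index set is abstract because termination and confluence use nothing
  about graphs.\<close>

definition reduces :: "'c set \<Rightarrow> ('c \<Rightarrow> 'x::finite \<Rightarrow>\<^sub>0 nat) \<Rightarrow> ('c \<Rightarrow> 'x \<Rightarrow>\<^sub>0 nat) \<Rightarrow> ('x \<Rightarrow>\<^sub>0 nat) \<Rightarrow> ('x \<Rightarrow>\<^sub>0 nat) \<Rightarrow> bool"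
  where "reduces A \<zeta> \<omega> \<mu> \<nu> \<longleftrightarrow> (\<exists>C\<in>A. \<exists>\<delta>. \<mu> = \<zeta> C + \<delta> \<and> \<nu> = \<omega> C + \<delta>)"

text \<open>Adding up the equations of the single steps eliminates the cofactors and remembers only
  which indices were used. For \<open>\<mu> = \<nu>\<close> cancellation leaves exactly an equality
  that condition (b) forbids.\<close>

lemma reduces_tranclpE:
  assumes "(reduces A \<zeta> \<omega>)\<^sup>+\<^sup>+ \<mu> \<nu>"
  obtains Cs where "Cs \<noteq> []" "set Cs \<subseteq> A"
    "\<mu> + sum_list (map \<omega> Cs) = \<nu> + sum_list (map \<zeta> Cs)"
proof -
  from assms have "\<exists>Cs. Cs \<noteq> [] \<and> set Cs \<subseteq> A \<and>
      \<mu> + sum_list (map \<omega> Cs) = \<nu> + sum_list (map \<zeta> Cs)"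
  proof (induction rule: tranclp_induct)
    case (base \<nu>)
    then obtain C \<delta> where "C \<in> A" "\<mu> = \<zeta> C + \<delta>" "\<nu> = \<omega> C + \<delta>" by (auto simp: reduces_def)
    then show ?case by (intro exI[of _ "[C]"]) (simp add: ac_simps)
  next
    case (step \<nu> \<xi>)
    then obtain C \<delta> Cs where C: "C \<in> A" "\<nu> = \<zeta> C + \<delta>" "\<xi> = \<omega> C + \<delta>"
      and Cs: "set Cs \<subseteq> A" "\<mu> + sum_list (map \<omega> Cs) = \<nu> + sum_list (map \<zeta> Cs)"
      by (auto simp: reduces_def)
    have "\<mu> + sum_list (map \<omega> (C # Cs)) = \<omega> C + (\<mu> + sum_list (map \<omega> Cs))" by (simp add: ac_simps)
    also have "\<dots> = \<xi> + sum_list (map \<zeta> (C # Cs))" unfolding Cs C by (simp add: ac_simps)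
    finally show ?case using C Cs by (intro exI[of _ "C # Cs"]) simp
  qed
  then show thesis using that by blast
qed

text \<open>Steps preserve the degree by \<open>deg\<close>, so from \<open>\<mu>\<close> they stay
  in a finite set, where acyclicity already yields well-foundedness; a cycle would contradict
  \<open>no_loop\<close>. A monomial that admits no further step is standard.\<close>

lemma reduces_to_standard:
  assumes deg: "\<And>C. C \<in> A \<Longrightarrow> total_deg (\<omega> C) = total_deg (\<zeta> C)"
    and no_loop: "\<And>Cs. Cs \<noteq> [] \<Longrightarrow> set Cs \<subseteq> A \<Longrightarrow> sum_list (map \<omega> Cs) \<noteq> sum_list (map \<zeta> Cs)"
  shows "\<exists>\<nu>. (reduces A \<zeta> \<omega>)\<^sup>*\<^sup>* \<mu> \<nu> \<and> (\<forall>C\<in>A. \<nexists>\<delta>. \<nu> = \<zeta> C + \<delta>)"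
proof -
  let ?M = "{\<nu>. total_deg \<nu> = total_deg \<mu>}"
  define r where "r = {(\<alpha>, \<beta>). \<alpha> \<in> ?M \<and> \<beta> \<in> ?M \<and> reduces A \<zeta> \<omega> \<alpha> \<beta>}"
  have "finite r"
    by (rule finite_subset[of _ "?M \<times> ?M"]) (auto simp: r_def intro!: finite_cartesian_product finite_total_deg)
  moreover have "acyclic r"
  proof (rule acyclicI, intro allI notI)
    fix \<alpha> assume "(\<alpha>, \<alpha>) \<in> r\<^sup>+"
    moreover have "r \<subseteq> {(\<alpha>, \<beta>). reduces A \<zeta> \<omega> \<alpha> \<beta>}" by (auto simp: r_def)
    ultimately have "(\<alpha>, \<alpha>) \<in> {(\<alpha>, \<beta>). reduces A \<zeta> \<omega> \<alpha> \<beta>}\<^sup>+" using trancl_mono by blast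
    then have "(reduces A \<zeta> \<omega>)\<^sup>+\<^sup>+ \<alpha> \<alpha>" by (simp add: tranclp_unfold)
    then show False by (rule reduces_tranclpE) (use no_loop in auto)
  qed
  ultimately have "wf (r\<inverse>)" by (rule finite_acyclic_wf_converse)
  then have "\<beta> \<in> ?M \<Longrightarrow> \<exists>\<nu>. (reduces A \<zeta> \<omega>)\<^sup>*\<^sup>* \<beta> \<nu> \<and> (\<forall>C\<in>A. \<nexists>\<delta>. \<nu> = \<zeta> C + \<delta>)" for \<beta>
  proof (induction \<beta> rule: wf_induct_rule)
    case (less \<beta>)
    show ?case
    proof (cases "\<exists>C\<in>A. \<exists>\<delta>. \<beta> = \<zeta> C + \<delta>")
      case True
      then obtain C \<delta> where C: "C \<in> A" "\<beta> = \<zeta> C + \<delta>" by blast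
      then have red: "reduces A \<zeta> \<omega> \<beta> (\<omega> C + \<delta>)" by (auto simp: reduces_def)
      with C less.prems deg have "(\<omega> C + \<delta>, \<beta>) \<in> r\<inverse>" "\<omega> C + \<delta> \<in> ?M"
        by (auto simp: r_def total_deg_add)
      from less.IH[OF this] red show ?thesis by (meson converse_rtranclp_into_rtranclp)
    qed auto
  qed
  then show ?thesis by simp
qed

text \<open>If two monomials with disjoint supports divide \<open>\<mu>\<close>, so does their
  product. Each step thus leaves the other one applicable, whatever variables the
  \<open>\<omega>\<close> introduce, and both orders end in the same monomial.\<close>

lemma confluentp_reduces:
  assumes disjoint: "\<And>C D i. C \<in> A \<Longrightarrow> D \<in> A \<Longrightarrow> C \<noteq> D \<Longrightarrow> lookup (\<zeta> C) i = 0 \<or> lookup (\<zeta> D) i = 0"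
  shows "confluentp (reduces A \<zeta> \<omega>)"
proof (rule strong_confluentp_imp_confluentp, rule strong_confluentpI)
  fix \<mu> \<nu> \<xi> assume "reduces A \<zeta> \<omega> \<mu> \<nu>" "reduces A \<zeta> \<omega> \<mu> \<xi>"
  then obtain C \<gamma> D \<delta> where C: "C \<in> A" "\<mu> = \<zeta> C + \<gamma>" "\<nu> = \<omega> C + \<gamma>"
    and D: "D \<in> A" "\<mu> = \<zeta> D + \<delta>" "\<xi> = \<omega> D + \<delta>"
    unfolding reduces_def by blast
  show "\<exists>\<upsilon>. (reduces A \<zeta> \<omega>)\<^sup>*\<^sup>* \<nu> \<upsilon> \<and> (reduces A \<zeta> \<omega>)\<^sup>=\<^sup>= \<xi> \<upsilon>"
  proof (cases "C = D")
    case True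
    then have "\<nu> = \<xi>" using C D by simp
    then show ?thesis by auto
  next
    case False
    \<comment> \<open>The cofactor left after removing both \<open>\<zeta> C\<close> and
      \<open>\<zeta> D\<close> from \<open>\<mu>\<close>. The truncated subtraction is exact: where
      \<open>\<zeta> D\<close> is positive, \<open>\<zeta> C\<close> vanishes and
      \<open>\<gamma>\<close> is at least \<open>\<zeta> D\<close>.\<close>
    define \<rho> where "\<rho> = \<gamma> - \<zeta> D"
    have pt: "lookup (\<zeta> C) i + lookup \<gamma> i = lookup (\<zeta> D) i + lookup \<delta> i" for i
      using C(2) D(2) by (metis lookup_add)
    have "lookup \<gamma> i = lookup (\<zeta> D + \<rho>) i \<and> lookup \<delta> i = lookup (\<zeta> C + \<rho>) i" for i
      using pt[of i] disjoint[OF C(1) D(1) False, of i] unfolding \<rho>_def lookup_add lookup_minus by linarith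
    then have "\<gamma> = \<zeta> D + \<rho>" "\<delta> = \<zeta> C + \<rho>" by (auto intro: poly_mapping_eqI)
    then have "reduces A \<zeta> \<omega> \<nu> (\<omega> C + \<omega> D + \<rho>)" "reduces A \<zeta> \<omega> \<xi> (\<omega> C + \<omega> D + \<rho>)"
      unfolding reduces_def
      using C D by (metis add.commute add.left_commute)+
    then show ?thesis by auto
  qed
qed

text \<open>By the Church-Rosser property equivalent monomials have a common reduct, and a monomial
  that admits no step is its only reduct.\<close>

lemma standard_unique:
  assumes "confluentp (reduces A \<zeta> \<omega>)" and equiv: "equivclp (reduces A \<zeta> \<omega>) \<mu> \<nu>"
    and std: "\<forall>C\<in>A. \<nexists>\<delta>. \<mu> = \<zeta> C + \<delta>" "\<forall>C\<in>A. \<nexists>\<delta>. \<nu> = \<zeta> C + \<delta>"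
  shows "\<mu> = \<nu>"
proof -
  obtain \<xi> where "(reduces A \<zeta> \<omega>)\<^sup>*\<^sup>* \<mu> \<xi>" "(reduces A \<zeta> \<omega>)\<^sup>*\<^sup>* \<nu> \<xi>"
    using equiv semiconfluentp_equivclp[OF confluentp_imp_semiconfluentp[OF assms(1)]]
    by (auto simp: rtranclp_conversep)
  moreover have "\<alpha> = \<xi>" if "(reduces A \<zeta> \<omega>)\<^sup>*\<^sup>* \<alpha> \<xi>" "\<forall>C\<in>A. \<nexists>\<delta>. \<alpha> = \<zeta> C + \<delta>" for \<alpha>
    using that by (cases rule: converse_rtranclpE) (auto simp: reduces_def)
  ultimately show ?thesis using std by metis
qed

section \<open>Quadratic binomials and 4-cycles\<close>

lemma total_deg_2E:
  assumes "total_deg \<mu> = 2"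
  obtains a c where "\<mu> = Poly_Mapping.single a 1 + Poly_Mapping.single c 1"
proof -
  from assms obtain \<nu> c where "\<mu> = \<nu> + Poly_Mapping.single c 1" "total_deg \<nu> = 1"
    by (metis Suc_1 total_deg_SucE)
  moreover from this(2) obtain \<xi> a where "\<nu> = \<xi> + Poly_Mapping.single a 1" "total_deg \<xi> = 0"
    by (metis One_nat_def total_deg_SucE)
  moreover from this(2) have "\<xi> = 0" by (intro poly_mapping_eqI) (simp add: total_deg_def)
  ultimately show thesis using that by simp
qed

lemma lookup_toric_exponent_pair:
  "lookup (toric_exponent e (Poly_Mapping.single a 1 + Poly_Mapping.single c 1)) v
     = of_bool (v \<in> e a) + of_bool (v \<in> e c)"
proof -
  have "lookup (toric_exponent e (Poly_Mapping.single i 1)) v = of_bool (v \<in> e i)" for i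
  proof -
    have "lookup (toric_exponent e (Poly_Mapping.single i 1)) v
        = (\<Sum>j\<in>UNIV. if j = i then of_bool (v \<in> e j) else 0)"
      unfolding lookup_toric_exponent by (intro sum.cong) (auto simp: lookup_single when_def)
    then show ?thesis by simp
  qed
  then show ?thesis by (simp only: toric_exponent_add lookup_add)
qed

text \<open>The two pairs of edges cover every vertex equally often. Once common edges are excluded
  by cancellation, each pair turns out to be disjoint, so both are perfect matchings of the same
  four vertices and their union is a 4-cycle. The disjunction records in which order
  \<open>b\<close> and \<open>d\<close> are met.\<close>

lemma equal_toric_exponent_imp_4cycle:
  assumes e: "simple_graph e"
    and neq: "Poly_Mapping.single a 1 + Poly_Mapping.single c 1 \<noteq> Poly_Mapping.single b 1 + Poly_Mapping.single d (1::nat)"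
    and eq: "toric_exponent e (Poly_Mapping.single a 1 + Poly_Mapping.single c 1)
      = toric_exponent e (Poly_Mapping.single b 1 + Poly_Mapping.single d 1)"
  shows "consecutive_4cycle e a b c d \<or> consecutive_4cycle e a d c b"
proof -
  have pair: "e i = {u, v}" if "u \<in> e i" "v \<in> e i" "u \<noteq> v" for i u v
    using e that by (intro card_subset_eq[symmetric]) (auto simp: simple_graph_def)
  have share: "i = j" if "u \<in> e i" "v \<in> e i" "u \<in> e j" "v \<in> e j" "u \<noteq> v" for i j u v
    using e pair[of u i v] pair[of u j v] that by (simp add: simple_graph_def inj_eq)
  have other: "\<exists>v\<in>e i. v \<noteq> u" for i u
    using e unfolding simple_graph_def card_2_iff by (metis insertI1 insertI2)
  have cnt: "of_bool (v \<in> e a) + of_bool (v \<in> e c) = of_bool (v \<in> e b) + (of_bool (v \<in> e d) :: nat)" for v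
    using arg_cong[OF eq, of "\<lambda>x. lookup x v"] unfolding lookup_toric_exponent_pair .
  have un: "e a \<union> e c = e b \<union> e d" and int: "e a \<inter> e c = e b \<inter> e d"
  proof -
    have "(v \<in> e a \<or> v \<in> e c \<longleftrightarrow> v \<in> e b \<or> v \<in> e d) \<and> (v \<in> e a \<and> v \<in> e c \<longleftrightarrow> v \<in> e b \<and> v \<in> e d)" for v
      using cnt[of v] by (cases "v \<in> e a"; cases "v \<in> e b"; cases "v \<in> e c"; cases "v \<in> e d") simp_all
    then show "e a \<union> e c = e b \<union> e d" "e a \<inter> e c = e b \<inter> e d"
      by (auto simp: set_eq_iff)
  qed
  have inj: "i = j" if "e i = e j" for i j
    using e that by (simp add: simple_graph_def inj_eq)
  \<comment> \<open>Union and intersection determine the second set of a pair from the first, so one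
    common edge would make the two monomials equal.\<close>
  have "c = d" if "a = b"
    by (rule inj) (use un int that in blast)
  moreover have "c = b" if "a = d"
    by (rule inj) (use un int that in blast)
  ultimately have ne: "a \<noteq> b" "a \<noteq> d"
    using neq by (metis add.commute)+
  \<comment> \<open>A vertex common to \<open>a\<close> and \<open>c\<close> also lies on
    \<open>b\<close> and \<open>d\<close>. The other end of \<open>a\<close> lies on one of these,
    which then has the same two ends as \<open>a\<close>.\<close>
  have disj: "e a \<inter> e c = {}"
  proof (rule equals0I)
    fix v assume "v \<in> e a \<inter> e c"
    then have v: "v \<in> e a" "v \<in> e b" "v \<in> e d" using int by blast+
    obtain x where "x \<in> e a" "x \<noteq> v" using other by blast
    moreover from this un have "x \<in> e b \<or> x \<in> e d" by blast
    ultimately show False using share v ne by blast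
  qed
  \<comment> \<open>Stated for \<open>b'\<close> and \<open>d'\<close> so that one argument covers
    both ways of distributing the ends of \<open>a\<close> over \<open>b\<close> and
    \<open>d\<close>. The cycle runs through \<open>q\<close>, \<open>p\<close>, \<open>r\<close>,
    \<open>s\<close>, where \<open>r\<close> and \<open>s\<close> are the far ends of
    \<open>b'\<close> and \<open>d'\<close>.\<close>
  have main: "consecutive_4cycle e a b' c d'"
    if "p \<in> e a" "q \<in> e a" "p \<noteq> q" "p \<in> e b'" "q \<in> e d'" "e a \<union> e c = e b' \<union> e d'" "e b' \<inter> e d' = {}"
    for p q b' d'
  proof -
    have a: "e a = {p, q}" using that by (intro pair)
    obtain r where r: "r \<in> e b'" "r \<noteq> p" using other by blast
    obtain s where s: "s \<in> e d'" "s \<noteq> q" using other by blast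
    have pq: "q \<notin> e b'" "p \<notin> e d'" using that by auto
    then have neq: "r \<noteq> q" "s \<noteq> p" using r s by auto
    then have "r \<notin> e a" "s \<notin> e a" using r s a by simp_all
    then have "r \<in> e c" "s \<in> e c" using that(6) r s by auto
    moreover have "r \<noteq> s" using that(7) r s by auto
    moreover from calculation have "e c = {r, s}" by (intro pair)
    moreover have "e b' = {p, r}" by (rule pair) (use that r in auto)
    moreover have "e d' = {q, s}" by (rule pair) (use that s in auto)
    moreover have "distinct [q, p, r, s]" using \<open>p \<noteq> q\<close> \<open>r \<noteq> s\<close> r s neq by auto
    moreover have "e a = {q, p}" "e d' = {s, q}" using a \<open>e d' = {q, s}\<close> by auto
    ultimately show ?thesis unfolding consecutive_4cycle_def by blast
  qed
  obtain p where p: "p \<in> e a" using other by blast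
  obtain q where q: "q \<in> e a" "q \<noteq> p" using other by blast
  \<comment> \<open>If \<open>b\<close> or \<open>d\<close> contained both ends of \<open>a\<close>,
    it would be equal to \<open>a\<close>.\<close>
  have bd: "p \<in> e b \<and> q \<in> e d \<or> p \<in> e d \<and> q \<in> e b"
    using un p q share[of p a q b] share[of p a q d] ne by blast
  have "e b \<inter> e d = {}" using disj int by simp
  with bd p q un show ?thesis
    using main[of p q b d] main[of p q d b] by (auto simp: Un_commute Int_commute)
qed

lemma consecutive_4cycle_disjoint:
  assumes "consecutive_4cycle e a b c d"
  shows "e a \<inter> e c = {}" "e b \<inter> e d = {}" "e a \<inter> e b \<noteq> {}" "e b \<inter> e c \<noteq> {}" "e c \<inter> e d \<noteq> {}"
    "e d \<inter> e a \<noteq> {}" "e a \<noteq> {}" "e b \<noteq> {}" "e c \<noteq> {}" "e d \<noteq> {}"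
proof -
  obtain v1 v2 v3 v4 where d: "distinct [v1, v2, v3, v4]"
    and e: "e a = {v1, v2}" "e b = {v2, v3}" "e c = {v3, v4}" "e d = {v4, v1}"
    using assms unfolding consecutive_4cycle_def by blast
  from d show "e a \<inter> e c = {}" "e b \<inter> e d = {}" "e a \<inter> e b \<noteq> {}" "e b \<inter> e c \<noteq> {}" "e c \<inter> e d \<noteq> {}"
    "e d \<inter> e a \<noteq> {}" "e a \<noteq> {}" "e b \<noteq> {}" "e c \<noteq> {}" "e d \<noteq> {}"
    unfolding e by auto
qed

text \<open>Opposite edges of a 4-cycle are its disjoint pairs, so the edge set alone determines the
  two monomials. This is what makes indexing the choice by edge sets harmless.\<close>

lemma consecutive_4cycle_opposite:
  assumes "consecutive_4cycle e a b c d" "consecutive_4cycle e a' b' c' d'" "{a, b, c, d} = {a', b', c', d'}"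
  shows "{a', c'} = {a, c} \<and> {b', d'} = {b, d} \<or> {a', c'} = {b, d} \<and> {b', d'} = {a, c}"
proof -
  note facts = consecutive_4cycle_disjoint[OF assms(1)] consecutive_4cycle_disjoint[OF assms(2)]
  \<comment> \<open>Adjacent edges meet, and \<open>x = y\<close> is excluded because edges are
    nonempty.\<close>
  have opp: "{x, y} = {a, c} \<or> {x, y} = {b, d}"
    if "x \<in> {a, b, c, d}" "y \<in> {a, b, c, d}" "e x \<inter> e y = {}" for x y
    using that facts(1-10) Int_commute[of "e b" "e a"] Int_commute[of "e c" "e b"]
      Int_commute[of "e d" "e c"] Int_commute[of "e a" "e d"]
    by (elim insertE emptyE) (simp_all add: insert_commute)
  have "a' \<in> {a, b, c, d}" "b' \<in> {a, b, c, d}" "c' \<in> {a, b, c, d}" "d' \<in> {a, b, c, d}"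
    unfolding assms(3) by simp_all
  then have cases: "{a', c'} = {a, c} \<or> {a', c'} = {b, d}" "{b', d'} = {a, c} \<or> {b', d'} = {b, d}"
    using opp facts(11,12) by simp_all
  have "b \<notin> {a, c}" "a \<notin> {b, d}" using facts(1-10) by (auto simp: Int_commute)
  moreover have "b \<in> {a', c'} \<union> {b', d'}" "a \<in> {a', c'} \<union> {b', d'}"
    using assms(3) by (simp_all add: set_eq_iff) metis+
  ultimately have "\<not> ({a', c'} = {a, c} \<and> {b', d'} = {a, c})" "\<not> ({a', c'} = {b, d} \<and> {b', d'} = {b, d})"
    by (metis Un_absorb)+
  with cases show ?thesis by blast
qed

lemma consecutive_4cycle_imp_equal_toric_exponent:
  assumes "consecutive_4cycle e a b c d"
  shows "toric_exponent e (Poly_Mapping.single a 1 + Poly_Mapping.single c 1)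
    = toric_exponent e (Poly_Mapping.single b 1 + Poly_Mapping.single d 1)"
proof (rule poly_mapping_eqI)
  fix v
  obtain v1 v2 v3 v4 where d: "distinct [v1, v2, v3, v4]"
    and e: "e a = {v1, v2}" "e b = {v2, v3}" "e c = {v3, v4}" "e d = {v4, v1}"
    using assms unfolding consecutive_4cycle_def by blast
  from d show "lookup (toric_exponent e (Poly_Mapping.single a 1 + Poly_Mapping.single c 1)) v
    = lookup (toric_exponent e (Poly_Mapping.single b 1 + Poly_Mapping.single d 1)) v"
    unfolding lookup_toric_exponent_pair e by (auto simp: of_bool_def)
qed

text \<open>The 4-cycle found from \<open>\<mu>\<close> and \<open>\<nu>\<close> has its own listing
  of edges, which need not be the listing behind \<open>\<zeta>\<close> and \<open>\<omega>\<close>.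
  Both give the same opposite pairs, and the direction of the step depends on which of the two
  monomials was chosen as non-standard.\<close>

lemma reduces_or_reduces:
  assumes "simple_graph e"
    and \<zeta>\<omega>: "\<And>C. C \<in> four_cycles e \<Longrightarrow> \<exists>a b c d. consecutive_4cycle e a b c d \<and> C = {a, b, c, d} \<and>
      \<zeta> C = Poly_Mapping.single a 1 + Poly_Mapping.single c 1 \<and>
      \<omega> C = Poly_Mapping.single b 1 + Poly_Mapping.single d 1"
    and deg: "total_deg \<mu> = 2" "total_deg \<nu> = 2"
    and neq: "\<mu> \<noteq> \<nu>" and eq: "toric_exponent e \<mu> = toric_exponent e \<nu>"
  shows "reduces (four_cycles e) \<zeta> \<omega> \<mu> \<nu> \<or> reduces (four_cycles e) \<zeta> \<omega> \<nu> \<mu>"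
proof -
  obtain a c where \<mu>: "\<mu> = Poly_Mapping.single a 1 + Poly_Mapping.single c 1"
    using deg(1) by (rule total_deg_2E)
  obtain b d where \<nu>: "\<nu> = Poly_Mapping.single b 1 + Poly_Mapping.single d 1"
    using deg(2) by (rule total_deg_2E)
  have "consecutive_4cycle e a b c d \<or> consecutive_4cycle e a d c b"
    using equal_toric_exponent_imp_4cycle[OF assms(1)] neq eq unfolding \<mu> \<nu> by blast
  then obtain b' d' where cyc: "consecutive_4cycle e a b' c d'" and "(b', d') = (b, d) \<or> (b', d') = (d, b)"
    by blast
  then have \<nu>': "\<nu> = Poly_Mapping.single b' 1 + Poly_Mapping.single d' 1" using \<nu> by (auto simp: add.commute)
  define C where "C = {a, b', c, d'}"
  have C: "C \<in> four_cycles e" using cyc unfolding C_def four_cycles_def by blast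
  from \<zeta>\<omega>[OF C] obtain p q r s where pqrs: "consecutive_4cycle e p q r s" "C = {p, q, r, s}"
    and \<zeta>: "\<zeta> C = Poly_Mapping.single p 1 + Poly_Mapping.single r 1"
    and \<omega>: "\<omega> C = Poly_Mapping.single q 1 + Poly_Mapping.single s 1" by blast
  have "{p, r} = {a, c} \<and> {q, s} = {b', d'} \<or> {p, r} = {b', d'} \<and> {q, s} = {a, c}"
    by (rule consecutive_4cycle_opposite[OF cyc pqrs(1)]) (use pqrs(2) C_def in simp)
  then have "\<zeta> C = \<mu> \<and> \<omega> C = \<nu> \<or> \<zeta> C = \<nu> \<and> \<omega> C = \<mu>"
    unfolding \<zeta> \<omega> \<mu> \<nu>' by (auto simp: doubleton_eq_iff add.commute)
  then show ?thesis using C unfolding reduces_def by (metis add_0_right)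
qed

section \<open>From quadratic generation to unique standard representatives\<close>

lemma reduces_shift: "reduces A \<zeta> \<omega> \<mu> \<nu> \<Longrightarrow> reduces A \<zeta> \<omega> (\<delta> + \<mu>) (\<delta> + \<nu>)"
  unfolding reduces_def by (metis add.left_commute)

text \<open>Functionals constant along steps kill the quadratic generators. Since steps can be
  shifted, the annihilator of these functionals is an ideal, so it contains the whole toric ideal.
  Evaluating the indicator of the class of \<open>\<mu>\<close> on
  \<open>mon \<mu> - mon \<nu>\<close> then puts \<open>\<nu>\<close> into that class.\<close>

lemma equivclp_reduces:
  fixes e :: "'n::finite \<Rightarrow> 'v::finite set"
  assumes gen: "generated_by_quadratic_binomials (toric_ideal e :: ('n, 'k::field) mpoly set)"
    and quadratic: "\<And>\<mu> \<nu>. total_deg \<mu> = 2 \<Longrightarrow> total_deg \<nu> = 2 \<Longrightarrow> \<mu> \<noteq> \<nu> \<Longrightarrow>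
      toric_exponent e \<mu> = toric_exponent e \<nu> \<Longrightarrow> reduces A \<zeta> \<omega> \<mu> \<nu> \<or> reduces A \<zeta> \<omega> \<nu> \<mu>"
    and eq: "toric_exponent e \<mu> = toric_exponent e \<nu>"
  shows "equivclp (reduces A \<zeta> \<omega>) \<mu> \<nu>"
proof -
  interpret cring "poly_ring :: ('n, 'k) mpoly ring" by (rule cring_from_type_algebra)
  let ?F = "{f :: _ \<Rightarrow> 'k. \<forall>\<alpha> \<beta>. reduces A \<zeta> \<omega> \<alpha> \<beta> \<longrightarrow> f \<alpha> = f \<beta>}"
  obtain B :: "('n, 'k) mpoly set" where B: "B \<subseteq> quadratic_binomials" "toric_ideal e = genideal poly_ring B"
    using gen unfolding generated_by_quadratic_binomials_def by blast
  have "B \<subseteq> annihilator ?F"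
  proof
    fix b assume "b \<in> B"
    then have "b \<in> toric_ideal e" "b \<in> quadratic_binomials" using B genideal_self[of B] by auto
    then obtain \<alpha> \<beta> where b: "b = mon \<alpha> - mon \<beta>" "total_deg \<alpha> = 2" "total_deg \<beta> = 2" "\<alpha> \<noteq> \<beta>"
      "toric_exponent e \<alpha> = toric_exponent e \<beta>"
      by (auto simp: quadratic_binomials_def monomials_def mon_diff_mem_toric_ideal_iff)
    then have "reduces A \<zeta> \<omega> \<alpha> \<beta> \<or> reduces A \<zeta> \<omega> \<beta> \<alpha>" by (intro quadratic)
    then have "f \<alpha> = f \<beta>" if "f \<in> ?F" for f using that by force
    then show "b \<in> annihilator ?F" unfolding b mon_diff_mem_annihilator_iff by blast
  qed
  moreover have "ideal (annihilator ?F) poly_ring"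
    by (rule ideal_annihilator) (blast intro: reduces_shift)
  ultimately have "toric_ideal e \<subseteq> annihilator ?F"
    unfolding B(2) by (intro genideal_minimal)
  then have "(mon \<mu> - mon \<nu> :: ('n, 'k) mpoly) \<in> annihilator ?F"
    using eq mon_diff_mem_toric_ideal_iff by blast
  then have "of_bool (equivclp (reduces A \<zeta> \<omega>) \<mu> \<mu>) = (of_bool (equivclp (reduces A \<zeta> \<omega>) \<mu> \<nu>) :: 'k)"
    unfolding mon_diff_mem_annihilator_iff
  proof (rule bspec)
    have "equivclp (reduces A \<zeta> \<omega>) \<mu> \<alpha> \<longleftrightarrow> equivclp (reduces A \<zeta> \<omega>) \<mu> \<beta>"
      if "reduces A \<zeta> \<omega> \<alpha> \<beta>" for \<alpha> \<beta>
      using that by (meson equivclp_sym equivclp_trans r_into_equivclp)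
    then show "(\<lambda>\<alpha>. of_bool (equivclp (reduces A \<zeta> \<omega>) \<mu> \<alpha>)) \<in> ?F" by simp
  qed
  then show ?thesis by (simp split: if_splits)
qed

text \<open>All that the dimension count needs from the rewriting: \<open>S\<close> collects the
  exponents of the standard monomials of all degrees and is a transversal of the toric
  fibres.\<close>

lemma standard_representatives:
  fixes e :: "'n::finite \<Rightarrow> 'v::finite set"
    and z w :: "'n set \<Rightarrow> ('n, 'k::field) mpoly"
  assumes e: "simple_graph e"
    and gen: "generated_by_quadratic_binomials (toric_ideal e :: ('n, 'k) mpoly set)"
    and good: "good_choice e z w"
  obtains S where "\<And>k. standard_monomials e z k = mon ` {\<mu>\<in>S. total_deg \<mu> = k}"
    and "\<And>\<mu>. \<exists>\<nu>\<in>S. toric_exponent e \<nu> = toric_exponent e \<mu>"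
    and "inj_on (toric_exponent e) S"
proof -
  let ?A = "four_cycles e"
  from good have nonstd: "nonstandard_choice e z w"
    and coprime: "\<forall>C\<in>?A. \<forall>D\<in>?A. C \<noteq> D \<longrightarrow> (\<forall>q. q dvd z C \<and> q dvd z D \<longrightarrow> q dvd 1)"
    and neq: "\<forall>Cs. Cs \<noteq> [] \<and> set Cs \<subseteq> ?A \<longrightarrow> prod_list (map w Cs) \<noteq> prod_list (map z Cs)"
    unfolding good_choice_def by simp_all
  \<comment> \<open>\<open>P\<close> hides the four edges, so that only the two exponent vectors
    have to be chosen as functions of the cycle.\<close>
  define P where "P C \<alpha> \<beta> \<longleftrightarrow> (\<exists>a b c d. consecutive_4cycle e a b c d \<and> C = {a, b, c, d} \<and>
      \<alpha> = Poly_Mapping.single a 1 + Poly_Mapping.single c (1::nat) \<and>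
      \<beta> = Poly_Mapping.single b 1 + Poly_Mapping.single d (1::nat))" for C \<alpha> \<beta>
  have "\<exists>\<alpha> \<beta>. P C \<alpha> \<beta> \<and> z C = mon \<alpha> \<and> w C = mon \<beta>" if "C \<in> ?A" for C
  proof -
    from nonstd obtain a b c d where cyc: "consecutive_4cycle e a b c d" "C = {a, b, c, d}"
      and zw: "z C = var a * var c" "w C = var b * var d"
      using \<open>C \<in> ?A\<close> unfolding nonstandard_choice_def by meson
    from cyc have "P C (Poly_Mapping.single a 1 + Poly_Mapping.single c 1)
        (Poly_Mapping.single b 1 + Poly_Mapping.single d 1)"
      unfolding P_def by blast
    with zw show ?thesis unfolding var_def mon_add[symmetric] by blast
  qed
  then obtain \<zeta> \<omega> where "\<And>C. C \<in> ?A \<Longrightarrow> P C (\<zeta> C) (\<omega> C)"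
    and zw: "\<And>C. C \<in> ?A \<Longrightarrow> z C = mon (\<zeta> C) \<and> w C = mon (\<omega> C)"
    by metis
  note \<zeta>\<omega> = this(1)[unfolded P_def]
  have deg: "total_deg (\<omega> C) = total_deg (\<zeta> C)" if "C \<in> ?A" for C
    using \<zeta>\<omega>[OF that] by (auto simp: total_deg_add)
  have toric: "toric_exponent e (\<omega> C) = toric_exponent e (\<zeta> C)" if C: "C \<in> ?A" for C
  proof -
    obtain a b c d where cyc: "consecutive_4cycle e a b c d"
      and eqs: "\<zeta> C = Poly_Mapping.single a 1 + Poly_Mapping.single c 1"
        "\<omega> C = Poly_Mapping.single b 1 + Poly_Mapping.single d 1"
      using \<zeta>\<omega>[OF C] by blast
    then show ?thesis using consecutive_4cycle_imp_equal_toric_exponent by metis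
  qed
  have no_loop: "sum_list (map \<omega> Cs) \<noteq> sum_list (map \<zeta> Cs)" if "Cs \<noteq> []" "set Cs \<subseteq> ?A" for Cs
  proof
    assume "sum_list (map \<omega> Cs) = sum_list (map \<zeta> Cs)"
    moreover have "map z Cs = map (\<lambda>C. mon (\<zeta> C)) Cs" "map w Cs = map (\<lambda>C. mon (\<omega> C)) Cs"
      using zw that by auto
    ultimately have "prod_list (map w Cs) = prod_list (map z Cs)" by (simp only: prod_list_mon)
    with neq that show False by simp
  qed
  have disjoint: "lookup (\<zeta> C) i = 0 \<or> lookup (\<zeta> D) i = 0"
    if CD: "C \<in> ?A" "D \<in> ?A" "C \<noteq> D" for C D i
  proof (rule ccontr)
    assume "\<not> ?thesis"
    then obtain \<alpha> \<beta> where "\<zeta> C = \<alpha> + Poly_Mapping.single i 1" "\<zeta> D = \<beta> + Poly_Mapping.single i 1"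
      using exponent_eq_single_add by (metis gr0I)
    then have "var i dvd z C" "var i dvd z D" using zw CD by (auto simp: mon_add var_def)
    then have "(var i :: ('n, 'k) mpoly) dvd 1" using coprime CD by metis
    then obtain \<delta> where "0 = Poly_Mapping.single i (1::nat) + \<delta>"
      unfolding var_def mon_0[symmetric] mon_dvd_mon_iff by blast
    then have "lookup 0 i = lookup (Poly_Mapping.single i (1::nat) + \<delta>) i" by simp
    then show False by (simp add: lookup_add)
  qed
  define S where "S = {\<mu>. \<forall>C\<in>?A. \<nexists>\<delta>. \<mu> = \<zeta> C + \<delta>}"
  show thesis
  proof
    show "standard_monomials e z k = mon ` {\<mu>\<in>S. total_deg \<mu> = k}" for k
      using zw by (auto simp: standard_monomials_def monomials_def S_def mon_dvd_mon_iff)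
  next
    fix \<mu>
    obtain \<nu> where "(reduces ?A \<zeta> \<omega>)\<^sup>*\<^sup>* \<mu> \<nu>" "\<nu> \<in> S"
      using reduces_to_standard[of ?A \<omega> \<zeta>, OF deg no_loop] unfolding S_def by blast
    moreover from this(1) have "toric_exponent e \<nu> = toric_exponent e \<mu>"
      by (induction rule: rtranclp_induct) (auto simp: reduces_def toric_exponent_add toric)
    ultimately show "\<exists>\<nu>\<in>S. toric_exponent e \<nu> = toric_exponent e \<mu>" by blast
  next
    show "inj_on (toric_exponent e) S"
    proof (rule inj_onI)
      fix \<mu> \<nu> assume "\<mu> \<in> S" "\<nu> \<in> S" and eq: "toric_exponent e \<mu> = toric_exponent e \<nu>"
      moreover have "equivclp (reduces ?A \<zeta> \<omega>) \<mu> \<nu>"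
        by (rule equivclp_reduces[OF gen _ eq]) (rule reduces_or_reduces[OF e \<zeta>\<omega>])
      ultimately show "\<mu> = \<nu>"
        using standard_unique[OF confluentp_reduces[of ?A \<zeta> \<omega>, OF disjoint]] unfolding S_def by blast
    qed
  qed
qed

section \<open>Powers of the maximal ideal\<close>

lemma ideal_generated_by_monomials:
  fixes I :: "('x::finite, 'k::field) mpoly set"
  assumes "ideal I poly_ring" and "\<And>\<mu>. \<mu> \<in> keys p \<Longrightarrow> mon \<mu> \<in> I"
  shows "p \<in> I"
proof -
  interpret I: ideal I "poly_ring :: ('x, 'k) mpoly ring" by fact
  have sum_mem: "sum f A \<in> I" if "\<And>\<mu>. \<mu> \<in> A \<Longrightarrow> f \<mu> \<in> I" for f :: "_ \<Rightarrow> ('x, 'k) mpoly" and A :: "('x \<Rightarrow>\<^sub>0 nat) set"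
    using that by (induction A rule: infinite_finite_induct) (use I.additive_subgroup_axioms[THEN additive_subgroup.zero_closed]
        I.additive_subgroup_axioms[THEN additive_subgroup.a_closed] in auto)
  have "Poly_Mapping.single \<mu> (lookup p \<mu>) \<in> I" if "\<mu> \<in> keys p" for \<mu>
    using I.I_l_closed[OF assms(2)[OF that], of "const (lookup p \<mu>)"] by (simp add: const_mult_mon)
  then have "(\<Sum>\<mu>\<in>keys p. Poly_Mapping.single \<mu> (lookup p \<mu>)) \<in> I" by (rule sum_mem)
  then show ?thesis by (simp only: poly_mapping_eq_sum_single[symmetric])
qed

text \<open>The \<open>k\<close>-th power of the ideal generated by the variables, described by
  supports so that no products of ideals have to be formed in the polynomial ring.\<close>

definition degree_ge :: "nat \<Rightarrow> ('x::finite, 'k::field) mpoly set" where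
  "degree_ge k = {p. \<forall>\<mu>\<in>keys p. k \<le> total_deg \<mu>}"

lemma mon_mem_degree_ge_iff [simp]: "mon \<mu> \<in> degree_ge k \<longleftrightarrow> k \<le> total_deg \<mu>"
  by (simp add: degree_ge_def mon_def)

lemma ideal_degree_ge: "ideal (degree_ge k :: ('x::finite, 'k::field) mpoly set) poly_ring"
proof (rule ideal_poly_ringI)
  fix p q :: "('x, 'k) mpoly" assume "p \<in> degree_ge k" "q \<in> degree_ge k"
  then show "p + q \<in> degree_ge k" using keys_add[of p q] unfolding degree_ge_def by blast
next
  fix r p :: "('x, 'k) mpoly" assume p: "p \<in> degree_ge k"
  have "k \<le> total_deg \<mu>" if \<mu>: "\<mu> \<in> keys (r * p)" for \<mu>
  proof -
    obtain \<alpha> \<beta> where "\<mu> = \<alpha> + \<beta>" "\<beta> \<in> keys p" using \<mu> keys_mult[of r p] by blast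
    with p show ?thesis by (simp add: degree_ge_def total_deg_add trans_le_add2)
  qed
  then show "r * p \<in> degree_ge k" by (simp add: degree_ge_def)
qed (simp add: degree_ge_def)

lemma degree_ge_mult: "p \<in> degree_ge k \<Longrightarrow> q \<in> degree_ge l \<Longrightarrow> p * q \<in> degree_ge (k + l)"
proof -
  assume pq: "p \<in> degree_ge k" "q \<in> degree_ge l"
  have "k + l \<le> total_deg \<mu>" if \<mu>: "\<mu> \<in> keys (p * q)" for \<mu>
  proof -
    obtain \<alpha> \<beta> where "\<mu> = \<alpha> + \<beta>" "\<alpha> \<in> keys p" "\<beta> \<in> keys q" using \<mu> keys_mult[of p q] by blast
    with pq show ?thesis by (simp add: degree_ge_def total_deg_add add_mono)
  qed
  then show ?thesis by (simp add: degree_ge_def)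
qed

text \<open>A monomial of positive degree splits off a variable. The hypothesis has the shape needed
  both for m itself, with \<open>k = 0\<close>, and for m^k times m.\<close>

lemma degree_ge_subset_ideal:
  fixes I :: "('x::finite, 'k::field) mpoly set"
  assumes I: "ideal I poly_ring" and "\<And>\<nu> i. k \<le> total_deg \<nu> \<Longrightarrow> mon \<nu> * var i \<in> I"
  shows "degree_ge (Suc k) \<subseteq> I"
proof
  fix p :: "('x, 'k) mpoly" assume p: "p \<in> degree_ge (Suc k)"
  show "p \<in> I"
  proof (rule ideal_generated_by_monomials[OF I])
    fix \<mu> assume "\<mu> \<in> keys p"
    with p have "Suc k \<le> total_deg \<mu>" by (simp add: degree_ge_def)
    then obtain m where "total_deg \<mu> = Suc m" "k \<le> m" by (metis Suc_le_D Suc_le_mono)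
    then obtain \<nu> i where "\<mu> = \<nu> + Poly_Mapping.single i 1" "k \<le> total_deg \<nu>"
      by (metis total_deg_SucE)
    with assms(2) show "mon \<mu> \<in> I" by (simp add: mon_add var_def)
  qed
qed

section \<open>Transport of ideals along ring homomorphisms, and the powers of the maximal
  ideal\<close>

lemma (in ring_hom_ring) ideal_vimage:
  assumes "ideal J S"
  shows "ideal {x \<in> carrier R. h x \<in> J} R"
proof -
  interpret J: ideal J S by fact
  note J = J.additive_subgroup_axioms
  show ?thesis
  proof (rule idealI)
    show "subgroup {x \<in> carrier R. h x \<in> J} (add_monoid R)"
      by (rule R.add.subgroupI)
        (auto simp: additive_subgroup.a_closed[OF J] additive_subgroup.zero_closed[OF J]
          additive_subgroup.a_inv_closed[OF J] simp flip: a_inv_def intro!: exI[of _ "\<zero>"])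
  qed (auto simp: J.I_l_closed J.I_r_closed R.ring_axioms)
qed

lemma (in ring_hom_ring) ideal_image:
  assumes "ideal I R" and surj: "h ` carrier R = carrier S"
  shows "ideal (h ` I) S"
proof -
  interpret I: ideal I R by fact
  note I = I.additive_subgroup_axioms
  have mem: "h x \<in> h ` I" if "x \<in> I" for x using that by blast
  show ?thesis
  proof (rule idealI)
    show "subgroup (h ` I) (add_monoid S)"
    proof (rule S.add.subgroupI)
      fix a b assume "a \<in> h ` I" "b \<in> h ` I"
      then obtain x y where "x \<in> I" "y \<in> I" "a = h x" "b = h y" by blast
      then show "a \<oplus>\<^bsub>S\<^esub> b \<in> h ` I" using mem[of "x \<oplus>\<^bsub>R\<^esub> y"] additive_subgroup.a_closed[OF I] by simp
    next
      fix a assume "a \<in> h ` I"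
      then obtain x where "x \<in> I" "a = h x" by blast
      then show "\<ominus>\<^bsub>S\<^esub> a \<in> h ` I"
        using mem[of "\<ominus>\<^bsub>R\<^esub> x"] additive_subgroup.a_inv_closed[OF I] by simp
    next
      show "h ` I \<noteq> {}" using additive_subgroup.zero_closed[OF I] by blast
    qed auto
  next
    fix a x assume "a \<in> h ` I" "x \<in> carrier S"
    then obtain b y where "b \<in> I" "a = h b" "y \<in> carrier R" "x = h y" using surj by blast
    then show "x \<otimes>\<^bsub>S\<^esub> a \<in> h ` I" "a \<otimes>\<^bsub>S\<^esub> x \<in> h ` I"
      using mem[of "y \<otimes>\<^bsub>R\<^esub> b"] mem[of "b \<otimes>\<^bsub>R\<^esub> y"] I.I_l_closed I.I_r_closed by simp_all
  qed (rule S.ring_axioms)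
qed

lemma ring_hom_residue_class:
  "ring_hom_ring (poly_ring :: ('n::finite, 'k::field) mpoly ring) (toric_ring e) (residue_class e)"
proof -
  interpret ideal "toric_ideal e :: ('n, 'k) mpoly set" poly_ring by (rule ideal_toric_ideal)
  show ?thesis
    using rcos_ring_hom_ring unfolding toric_ring_def residue_class_def[abs_def] .
qed

lemma carrier_toric_ring: "carrier (toric_ring e) = range (residue_class e)"
  by (auto simp: toric_ring_def FactRing_def A_RCOSETS_def' residue_class_def)

lemma residue_class_eq_iff:
  fixes p q :: "('n::finite, 'k::field) mpoly"
  shows "residue_class e p = residue_class e q \<longleftrightarrow> p - q \<in> toric_ideal e"
proof -
  interpret cring "poly_ring :: ('n, 'k) mpoly ring" by (rule cring_from_type_algebra)
  show ?thesis
    using quotient_eq_iff_same_a_r_cos[OF ideal_toric_ideal[of e], of p q]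
    by (simp add: residue_class_def)
qed

lemma max_ideal_eq: "max_ideal e = residue_class e ` (degree_ge 1 :: ('n::finite, 'k::field) mpoly set)"
proof -
  interpret h: ring_hom_ring "poly_ring :: ('n, 'k) mpoly ring" "toric_ring e" "residue_class e"
    by (rule ring_hom_residue_class)
  let ?G = "range (\<lambda>i. residue_class e (var i :: ('n, 'k) mpoly))"
  have G: "?G \<subseteq> carrier (toric_ring e)" by (auto simp: carrier_toric_ring)
  have I: "ideal (max_ideal e :: ('n, 'k) mpoly set set) (toric_ring e)"
    unfolding max_ideal_def by (rule h.S.genideal_ideal[OF G])
  show ?thesis
  proof
    show "max_ideal e \<subseteq> residue_class e ` (degree_ge 1 :: ('n, 'k) mpoly set)"
      unfolding max_ideal_def
    proof (rule h.S.genideal_minimal)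
      show "ideal (residue_class e ` (degree_ge 1 :: ('n, 'k) mpoly set)) (toric_ring e)"
        by (rule h.ideal_image[OF ideal_degree_ge]) (simp add: carrier_toric_ring)
    qed (auto simp: var_def)
    have "degree_ge (Suc 0) \<subseteq> {p \<in> carrier poly_ring. residue_class e (p :: ('n, 'k) mpoly) \<in> max_ideal e}"
    proof (rule degree_ge_subset_ideal[OF h.ideal_vimage[OF I]])
      fix \<nu> :: "'n \<Rightarrow>\<^sub>0 nat" and i
      have "residue_class e (var i :: ('n, 'k) mpoly) \<in> max_ideal e"
        unfolding max_ideal_def using h.S.genideal_self[OF G] by blast
      then show "mon \<nu> * var i \<in> {p \<in> carrier poly_ring. residue_class e (p :: ('n, 'k) mpoly) \<in> max_ideal e}"
        using ideal.I_l_closed[OF I, of _ "residue_class e (mon \<nu>)"] h.hom_mult[of "mon \<nu>" "var i"] by simp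
    qed
    then show "residue_class e ` (degree_ge 1 :: ('n, 'k) mpoly set) \<subseteq> max_ideal e" by auto
  qed
qed

text \<open>The zeroth power is the whole ring, matching \<open>degree_ge 0\<close>. In the step,
  degrees add under products, and conversely each monomial of degree above \<open>k\<close> is one
  of degree at least \<open>k\<close> times a variable.\<close>

lemma max_ideal_pow_eq:
  "max_ideal_pow e k = residue_class e ` (degree_ge k :: ('n::finite, 'k::field) mpoly set)"
proof (induction k)
  case 0
  have "degree_ge 0 = (UNIV :: ('n, 'k) mpoly set)" by (simp add: degree_ge_def)
  then show ?case by (simp add: max_ideal_pow_def ideals_set_def carrier_toric_ring)
next
  case (Suc k)
  interpret h: ring_hom_ring "poly_ring :: ('n, 'k) mpoly ring" "toric_ring e" "residue_class e"
    by (rule ring_hom_residue_class)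
  have img: "ideal (residue_class e ` (degree_ge l :: ('n, 'k) mpoly set)) (toric_ring e)" for l
    by (rule h.ideal_image[OF ideal_degree_ge]) (simp add: carrier_toric_ring)
  let ?P = "ideal_prod (toric_ring e) (residue_class e ` (degree_ge k :: ('n, 'k) mpoly set)) (residue_class e ` degree_ge 1)"
  have "max_ideal_pow e (Suc k) = ?P"
    using Suc by (simp add: max_ideal_pow_def ideals_set_def max_ideal_eq)
  also have "?P = residue_class e ` degree_ge (Suc k)"
  proof
    have "x \<in> residue_class e ` degree_ge (Suc k)" if "x \<in> ?P" for x
      using that
    proof (induction rule: ideal_prod.induct)
      case (prod a b)
      then obtain p q :: "('n, 'k) mpoly" where pq: "p \<in> degree_ge k" "q \<in> degree_ge 1"
        "a = residue_class e p" "b = residue_class e q" by blast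
      then have "a \<otimes>\<^bsub>toric_ring e\<^esub> b = residue_class e (p * q)" using h.hom_mult[of p q] by simp
      then show ?case using degree_ge_mult[OF pq(1,2)] by simp
    next
      case (sum a b)
      interpret ideal "residue_class e ` (degree_ge (Suc k) :: ('n, 'k) mpoly set)" "toric_ring e" by (rule img)
      show ?case using sum.IH by (rule additive_subgroup.a_closed[OF additive_subgroup_axioms])
    qed
    then show "?P \<subseteq> residue_class e ` degree_ge (Suc k)" by blast
    \<comment> \<open>The inclusion is checked in the polynomial ring, where the preimage of the
      product ideal is again an ideal and monomials are available.\<close>
    have "degree_ge (Suc k) \<subseteq> {p \<in> carrier poly_ring. residue_class e (p :: ('n, 'k) mpoly) \<in> ?P}"
    proof (rule degree_ge_subset_ideal[OF h.ideal_vimage[OF h.S.ideal_prod_is_ideal[OF img img]]])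
      fix \<nu> :: "'n \<Rightarrow>\<^sub>0 nat" and i assume "k \<le> total_deg \<nu>"
      then have "residue_class e (mon \<nu>) \<otimes>\<^bsub>toric_ring e\<^esub> residue_class e (var i :: ('n, 'k) mpoly) \<in> ?P"
        by (intro ideal_prod.prod) (auto simp: var_def)
      then show "mon \<nu> * var i \<in> {p \<in> carrier poly_ring. residue_class e (p :: ('n, 'k) mpoly) \<in> ?P}"
        using h.hom_mult[of "mon \<nu>" "var i"] by simp
    qed
    then show "residue_class e ` degree_ge (Suc k) \<subseteq> ?P" by blast
  qed
  finally show ?case .
qed

section \<open>The graded pieces\<close>

definition truncated_class ::
  "('n::finite \<Rightarrow> 'v::finite set) \<Rightarrow> nat \<Rightarrow> ('n, 'k::field) mpoly \<Rightarrow> ('n, 'k) mpoly set set" where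
  "truncated_class e k p = max_ideal_pow e (Suc k) +>\<^bsub>toric_ring e\<^esub> residue_class e p"

lemma ideal_max_ideal_pow: "ideal (max_ideal_pow e k :: ('n::finite, 'k::field) mpoly set set) (toric_ring e)"
proof -
  interpret h: ring_hom_ring "poly_ring :: ('n, 'k) mpoly ring" "toric_ring e" "residue_class e"
    by (rule ring_hom_residue_class)
  show ?thesis
    unfolding max_ideal_pow_eq by (rule h.ideal_image[OF ideal_degree_ge]) (simp add: carrier_toric_ring)
qed

lemma ring_hom_truncated_class:
  "ring_hom_ring (poly_ring :: ('n::finite, 'k::field) mpoly ring) (truncated_ring e k) (truncated_class e k)"
proof -
  interpret h: ring_hom_ring "poly_ring :: ('n, 'k) mpoly ring" "toric_ring e" "residue_class e"
    by (rule ring_hom_residue_class)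
  interpret I: ideal "max_ideal_pow e (Suc k) :: ('n, 'k) mpoly set set" "toric_ring e"
    by (rule ideal_max_ideal_pow)
  interpret g: ring_hom_ring "toric_ring e :: ('n, 'k) mpoly set ring" "truncated_ring e k"
      "\<lambda>x. max_ideal_pow e (Suc k) +>\<^bsub>toric_ring e\<^esub> x"
    unfolding truncated_ring_def by (rule I.rcos_ring_hom_ring)
  show ?thesis
  proof (rule ring_hom_ringI)
    fix p q :: "('n, 'k) mpoly"
    show "truncated_class e k (p \<otimes>\<^bsub>poly_ring\<^esub> q)
      = truncated_class e k p \<otimes>\<^bsub>truncated_ring e k\<^esub> truncated_class e k q"
      using h.hom_mult[of p q] by (simp add: truncated_class_def)
    show "truncated_class e k (p \<oplus>\<^bsub>poly_ring\<^esub> q)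
      = truncated_class e k p \<oplus>\<^bsub>truncated_ring e k\<^esub> truncated_class e k q"
      using h.hom_add[of p q] by (simp add: truncated_class_def)
    show "truncated_class e k p \<in> carrier (truncated_ring e k)"
      by (simp add: truncated_class_def)
    show "truncated_class e k \<one>\<^bsub>poly_ring\<^esub> = (\<one>\<^bsub>truncated_ring e k\<^esub> :: ('n, 'k) mpoly set set)"
      unfolding truncated_class_def by (simp only: h.hom_one g.hom_one)
  qed (rule h.R.ring_axioms g.S.ring_axioms)+
qed

text \<open>The kernel of the composite quotient map is the sum of the toric ideal and
  \<open>degree_ge (Suc k)\<close>; \<open>r\<close> is the summand of high degree.\<close>

lemma truncated_class_eq_iff:
  fixes p q :: "('n::finite, 'k::field) mpoly"
  shows "truncated_class e k p = truncated_class e k q \<longleftrightarrow> (\<exists>r\<in>degree_ge (Suc k). p - q - r \<in> toric_ideal e)"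
proof -
  interpret h: ring_hom_ring "poly_ring :: ('n, 'k) mpoly ring" "toric_ring e" "residue_class e"
    by (rule ring_hom_residue_class)
  have "residue_class e p \<ominus>\<^bsub>toric_ring e\<^esub> residue_class e q = residue_class e (p - q)"
    using h.hom_add[of p "- q"] h.hom_a_inv[of q] by (simp add: a_minus_def)
  then have "truncated_class e k p = truncated_class e k q \<longleftrightarrow> residue_class e (p - q) \<in> max_ideal_pow e (Suc k)"
    using h.S.quotient_eq_iff_same_a_r_cos[OF ideal_max_ideal_pow, of "residue_class e p" "residue_class e q" "Suc k"]
    by (simp add: truncated_class_def)
  then show ?thesis by (auto simp: max_ideal_pow_eq residue_class_eq_iff)
qed

text \<open>\<open>inv\<close> makes the functional vanish on the toric ideal and
  \<open>high\<close> on \<open>degree_ge (Suc k)\<close>, so it factors through R/m^(k+1) and can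
  detect nonzero classes there.\<close>

lemma pairing_eq_0:
  fixes p :: "('n::finite, 'k::field) mpoly"
  assumes "truncated_class e k p = truncated_class e k 0"
    and inv: "\<And>\<mu> \<nu>. toric_exponent e \<mu> = toric_exponent e \<nu> \<Longrightarrow> f \<mu> = f \<nu>"
    and high: "\<And>\<mu>. k < total_deg \<mu> \<Longrightarrow> f \<mu> = 0"
  shows "pairing f p = 0"
proof -
  obtain r where r: "r \<in> degree_ge (Suc k)" "p - r \<in> toric_ideal e"
    using assms(1) unfolding truncated_class_eq_iff by auto
  have "f \<in> {f. \<forall>\<mu> \<nu>. toric_exponent e \<mu> = toric_exponent e \<nu> \<longrightarrow> f \<mu> = f \<nu>}"
    using inv by blast
  with r(2) have "pairing f (p - r) = 0"
    unfolding toric_ideal_eq_annihilator annihilator_def by blast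
  moreover have "pairing f r = 0"
    unfolding pairing_def
  proof (rule sum.neutral, rule ballI)
    fix \<mu> assume "\<mu> \<in> keys r"
    with r(1) have "k < total_deg \<mu>" by (auto simp: degree_ge_def)
    then show "lookup r \<mu> * f \<mu> = 0" by (simp add: high)
  qed
  ultimately show ?thesis by (simp add: pairing_diff)
qed

text \<open>\<open>combine\<close> stops at the end of the shorter list, just as \<open>zip\<close>
  does, so the identity holds for lists of any lengths.\<close>

lemma combine_truncated_class:
  fixes cs :: "'k::field list" and \<mu>s :: "('n::finite \<Rightarrow>\<^sub>0 nat) list"
  shows "ring.combine (truncated_ring e k) (map (\<lambda>c. truncated_class e k (const c)) cs)
      (map (\<lambda>\<mu>. truncated_class e k (mon \<mu>)) \<mu>s)
    = truncated_class e k (\<Sum>(c, \<mu>)\<leftarrow>zip cs \<mu>s. Poly_Mapping.single \<mu> c)"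
proof -
  interpret h: ring_hom_ring "poly_ring :: ('n, 'k) mpoly ring" "truncated_ring e k" "truncated_class e k"
    by (rule ring_hom_truncated_class)
  have zero: "truncated_class e k (0 :: ('n, 'k) mpoly) = \<zero>\<^bsub>truncated_ring e k\<^esub>" using h.hom_zero by simp
  show ?thesis
  proof (induction cs \<mu>s rule: list_induct2')
    case (4 c cs \<mu> \<mu>s)
    have "truncated_class e k (const c) \<otimes>\<^bsub>truncated_ring e k\<^esub> truncated_class e k (mon \<mu>)
        = truncated_class e k (Poly_Mapping.single \<mu> c)"
      using h.hom_mult[of "const c" "mon \<mu>"] by (simp add: const_mult_mon)
    with 4 show ?case using h.hom_add[of "Poly_Mapping.single \<mu> c"] by simp
  qed (simp_all add: zero)
qed

lemma sum_list_zip_select: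
  fixes cs :: "'k::semiring_1 list"
  assumes "distinct ys" "j < length cs" "j < length ys"
  shows "(\<Sum>(c, y)\<leftarrow>zip cs ys. c * of_bool (y = ys ! j)) = cs ! j"
proof -
  have "(\<Sum>(c, y)\<leftarrow>zip cs ys. c * of_bool (y = ys ! j))
      = (\<Sum>i<min (length cs) (length ys). cs ! i * of_bool (ys ! i = ys ! j))"
    by (simp add: sum_list_sum_nth atLeast0LessThan)
  also have "\<dots> = (\<Sum>i<min (length cs) (length ys). if i = j then cs ! i else 0)"
    using assms by (intro sum.cong refl) (auto simp: nth_eq_iff_index_eq)
  finally show ?thesis using assms by simp
qed

lemma ring_hom_const: "ring_hom_ring (ring_of_type_algebra :: 'k::field ring) (poly_ring :: ('n::finite, 'k) mpoly ring) const"
  by (rule ring_hom_ringI)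
    (auto simp: ring_of_type_algebra_def const_def mult_single single_add
      intro!: ring_from_type_algebra[unfolded ring_of_type_algebra_def])

text \<open>The image of a field under a ring homomorphism is a field unless 1 becomes 0. The
  constant-term functional excludes this: it takes the value 1 at 1 and is constant on toric fibres
  because these determine the degree.\<close>

lemma subfield_scalars:
  fixes e :: "'n::finite \<Rightarrow> 'v::finite set"
  assumes "simple_graph e"
  shows "subfield (scalars e k) (truncated_ring e k :: ('n, 'k::field) mpoly set set ring)"
proof -
  interpret F: field "ring_of_type_algebra :: 'k ring" by (rule field_from_type_algebra)
  interpret c: ring_hom_ring "ring_of_type_algebra :: 'k ring" "poly_ring :: ('n, 'k) mpoly ring" const
    by (rule ring_hom_const)
  interpret h: ring_hom_ring "poly_ring :: ('n, 'k) mpoly ring" "truncated_ring e k" "truncated_class e k"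
    by (rule ring_hom_truncated_class)
  have field: "subfield (range const) (poly_ring :: ('n, 'k) mpoly ring)"
    using c.img_is_subfield(2)[OF F.carrier_is_subfield] by (simp add: ring_of_type_algebra_def)
  have "truncated_class e k 1 \<noteq> truncated_class e k (0 :: ('n, 'k) mpoly)"
  proof
    assume *: "truncated_class e k 1 = truncated_class e k (0 :: ('n, 'k) mpoly)"
    have "pairing (\<lambda>\<mu>. of_bool (total_deg \<mu> = 0)) (1 :: ('n, 'k) mpoly) = 0"
    proof (rule pairing_eq_0[OF *])
      fix \<mu> \<nu> :: "'n \<Rightarrow>\<^sub>0 nat" assume "toric_exponent e \<mu> = toric_exponent e \<nu>"
      then have "total_deg \<mu> = total_deg \<nu>"
        using total_deg_toric_exponent[OF assms, of \<mu>] total_deg_toric_exponent[OF assms, of \<nu>] by simp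
      then show "of_bool (total_deg \<mu> = 0) = (of_bool (total_deg \<nu> = 0) :: 'k)" by simp
    qed simp
    then show False by (simp add: mon_0[symmetric] pairing_mon) (simp add: total_deg_def)
  qed
  then have "\<one>\<^bsub>truncated_ring e k\<^esub> \<noteq> (\<zero>\<^bsub>truncated_ring e k\<^esub> :: ('n, 'k) mpoly set set)"
    using h.hom_one h.hom_zero by simp
  then have "subfield (truncated_class e k ` range const) (truncated_ring e k :: ('n, 'k) mpoly set set ring)"
    using h.img_is_subfield(2)[OF field] by simp
  moreover have "scalars e k = truncated_class e k ` range (const :: 'k \<Rightarrow> ('n, 'k) mpoly)"
    by (auto simp: scalars_def truncated_class_def)
  ultimately show ?thesis by simp
qed

lemma scalars_eq: "scalars e k = range (\<lambda>c. truncated_class e k (const c))"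
  by (simp add: scalars_def truncated_class_def)

lemma power_quotient_eq: "power_quotient e k = truncated_class e k ` degree_ge k"
  by (simp add: power_quotient_def truncated_class_def max_ideal_pow_eq image_image)

theorem theorem3p6:
  fixes e :: "'n::finite \<Rightarrow> 'v::finite set"
    and z w :: "'n set \<Rightarrow> ('n, 'k::field) mpoly"
    and k :: nat
  assumes "simple_graph e"
    and "connected_graph e"
    and "bipartite_graph e"
    and "generated_by_quadratic_binomials (toric_ideal e :: ('n, 'k) mpoly set)"
    and "good_choice e z w"
  shows "ring.dimension (truncated_ring e k :: ('n, 'k) mpoly set set ring)
           (card (standard_monomials e z k)) (scalars e k) (power_quotient e k)"
proof -
  interpret h: ring_hom_ring "poly_ring :: ('n, 'k) mpoly ring" "truncated_ring e k" "truncated_class e k"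
    by (rule ring_hom_truncated_class)
  let ?cl = "truncated_class e k :: ('n, 'k) mpoly \<Rightarrow> _"
  have zero: "\<zero>\<^bsub>truncated_ring e k\<^esub> = ?cl 0" using h.hom_zero by simp
  have K: "subfield (scalars e k) (truncated_ring e k :: ('n, 'k) mpoly set set ring)"
    using assms(1) by (rule subfield_scalars)
  obtain S where S: "\<And>k. standard_monomials e z k = mon ` {\<mu>\<in>S. total_deg \<mu> = k}"
    and ex: "\<And>\<mu>. \<exists>\<nu>\<in>S. toric_exponent e \<nu> = toric_exponent e \<mu>"
    and inj: "inj_on (toric_exponent e) S"
    by (rule standard_representatives[OF assms(1,4,5)]) blast
  have deg_eq: "total_deg \<mu> = total_deg \<nu>" if "toric_exponent e \<mu> = toric_exponent e \<nu>" for \<mu> \<nu>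
    using that total_deg_toric_exponent[OF assms(1), of \<mu>] total_deg_toric_exponent[OF assms(1), of \<nu>] by simp
  have "finite {\<mu>\<in>S. total_deg \<mu> = k}"
    using finite_total_deg[of k] by (rule rev_finite_subset) blast
  then obtain \<mu>s where \<mu>s: "set \<mu>s = {\<mu>\<in>S. total_deg \<mu> = k}" "distinct \<mu>s"
    using finite_distinct_list by blast
  \<comment> \<open>The intended basis: the classes of the standard monomials of degree
    \<open>k\<close>, as a list without repeated exponents.\<close>
  define Us where "Us = map (\<lambda>\<mu>. ?cl (mon \<mu>)) \<mu>s"
  have Us: "set Us \<subseteq> carrier (truncated_ring e k)" unfolding Us_def by auto
  have "inj_on (mon :: _ \<Rightarrow> ('n, 'k) mpoly) A" for A by (auto intro: inj_onI)
  then have len: "card (standard_monomials e z k) = length Us"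
    unfolding S by (simp add: card_image \<mu>s(1)[symmetric] distinct_card[OF \<mu>s(2)] Us_def)
  have comb: "\<exists>cs. Ks = map (\<lambda>c. ?cl (const c)) cs \<and>
      h.S.combine Ks Us = ?cl (\<Sum>(c, \<mu>)\<leftarrow>zip cs \<mu>s. Poly_Mapping.single \<mu> c)"
    if "set Ks \<subseteq> scalars e k" for Ks
  proof -
    have "\<forall>x\<in>set Ks. \<exists>c. x = ?cl (const c)"
      using \<open>set Ks \<subseteq> scalars e k\<close> unfolding scalars_eq by auto
    then obtain cs where "Ks = map (\<lambda>c. ?cl (const c)) cs"
      unfolding ex_map_conv[symmetric] ..
    then show ?thesis unfolding Us_def using combine_truncated_class by blast
  qed
  have "h.S.independent (scalars e k) Us"
  proof (rule h.S.trivial_combine_imp_independent[OF K Us], rule subsetI)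
    fix Ks x assume Ks: "set Ks \<subseteq> scalars e k" "h.S.combine Ks Us = \<zero>\<^bsub>truncated_ring e k\<^esub>"
      and "x \<in> set (take (length Us) Ks)"
    \<comment> \<open>\<open>Ks\<close> may differ in length from \<open>Us\<close>; only
      coefficients at positions present in both lists enter the combination.\<close>
    then obtain j where j: "j < length \<mu>s" "j < length Ks" "x = Ks ! j"
      by (auto simp: in_set_conv_nth Us_def)
    obtain cs where cs: "Ks = map (\<lambda>c. ?cl (const c)) cs"
      "h.S.combine Ks Us = ?cl (\<Sum>(c, \<mu>)\<leftarrow>zip cs \<mu>s. Poly_Mapping.single \<mu> c)"
      using comb[OF Ks(1)] by blast
    \<comment> \<open>The dual functional of the \<open>j\<close>-th basis element. Standard
      monomials lie in distinct fibres, so it vanishes on the others and extracts the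
      \<open>j\<close>-th coefficient.\<close>
    define f where "f \<mu> = (of_bool (toric_exponent e \<mu> = toric_exponent e (\<mu>s ! j)) :: 'k)" for \<mu>
    have j_mem: "\<mu>s ! j \<in> S" "total_deg (\<mu>s ! j) = k" using \<mu>s(1) nth_mem[OF j(1)] by auto
    have "pairing f (\<Sum>(c, \<mu>)\<leftarrow>zip cs \<mu>s. Poly_Mapping.single \<mu> c) = 0"
    proof (rule pairing_eq_0[of e k])
      show "?cl (\<Sum>(c, \<mu>)\<leftarrow>zip cs \<mu>s. Poly_Mapping.single \<mu> c) = ?cl 0"
        using cs(2) Ks(2) zero by simp
      show "f \<mu> = 0" if "k < total_deg \<mu>" for \<mu>
        using that deg_eq[of \<mu> "\<mu>s ! j"] j_mem(2) by (auto simp: f_def)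
    qed (simp add: f_def)
    moreover have "pairing f (\<Sum>(c, \<mu>)\<leftarrow>xs. Poly_Mapping.single \<mu> c) = (\<Sum>(c, \<mu>)\<leftarrow>xs. c * f \<mu>)" for xs
      by (induction xs) (auto simp: pairing_add pairing_single)
    moreover have "(\<Sum>(c, \<mu>)\<leftarrow>zip cs \<mu>s. c * f \<mu>) = (\<Sum>(c, \<mu>)\<leftarrow>zip cs \<mu>s. c * of_bool (\<mu> = \<mu>s ! j))"
    proof (rule arg_cong[where f = sum_list], rule map_cong[OF refl], clarify)
      fix c \<mu> assume "(c, \<mu>) \<in> set (zip cs \<mu>s)"
      then have "\<mu> \<in> S" using \<mu>s(1) set_zip_rightD by fastforce
      then show "c * f \<mu> = c * of_bool (\<mu> = \<mu>s ! j)"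
        using inj_on_eq_iff[OF inj _ j_mem(1)] by (simp add: f_def)
    qed
    ultimately have "cs ! j = 0"
      using sum_list_zip_select[OF \<mu>s(2), of j cs] j cs(1) by simp
    then show "x \<in> {\<zero>\<^bsub>truncated_ring e k\<^esub>}"
      using j cs(1) by (simp add: zero const_def)
  qed
  moreover have "h.S.Span (scalars e k) Us = power_quotient e k"
  proof
    have "h.S.combine Ks Us \<in> power_quotient e k" if Ks: "set Ks \<subseteq> scalars e k" for Ks
    proof -
      obtain cs where cs: "h.S.combine Ks Us = ?cl (\<Sum>(c, \<mu>)\<leftarrow>zip cs \<mu>s. Poly_Mapping.single \<mu> c)"
        using comb[OF Ks] by blast
      interpret D: ideal "degree_ge k :: ('n, 'k) mpoly set" poly_ring by (rule ideal_degree_ge)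
      note D = D.additive_subgroup_axioms
      have sum_mem: "(\<Sum>(c, \<mu>)\<leftarrow>xs. Poly_Mapping.single \<mu> c) \<in> (degree_ge k :: ('n, 'k) mpoly set)"
        if "snd ` set xs \<subseteq> set \<mu>s" for xs
        using that
      proof (induction xs)
        case (Cons x xs)
        then have "Poly_Mapping.single (snd x) (fst x) \<in> degree_ge k"
          using \<mu>s(1) by (auto simp: degree_ge_def)
        with Cons show ?case
          using additive_subgroup.a_closed[OF D] by (simp add: case_prod_beta)
      qed (use additive_subgroup.zero_closed[OF D] in simp)
      have "snd ` set (zip cs \<mu>s) \<subseteq> set \<mu>s" by (auto dest: set_zip_rightD)
      then show ?thesis unfolding cs power_quotient_eq by (intro imageI sum_mem)
    qed
    then show "h.S.Span (scalars e k) Us \<subseteq> power_quotient e k"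
      unfolding h.S.Span_eq_combine_set[OF K Us] by blast
    \<comment> \<open>In degree \<open>k\<close> the monomial has the same class as the standard one
      in its fibre; in higher degree its class is zero.\<close>
    have single: "?cl (Poly_Mapping.single \<mu> c) \<in> h.S.Span (scalars e k) Us" if "k \<le> total_deg \<mu>" for \<mu> c
    proof (cases "total_deg \<mu> = k")
      case True
      obtain \<nu> where \<nu>: "\<nu> \<in> S" "toric_exponent e \<nu> = toric_exponent e \<mu>" using ex by blast
      with True have "\<nu> \<in> set \<mu>s" using \<mu>s(1) deg_eq[OF \<nu>(2)] by simp
      then have "?cl (mon \<nu>) \<in> h.S.Span (scalars e k) Us"
        using h.S.Span_base_incl[OF K Us] by (auto simp: Us_def)
      moreover have "?cl (const c) \<in> scalars e k" by (simp add: scalars_eq)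
      ultimately have "?cl (const c) \<otimes>\<^bsub>truncated_ring e k\<^esub> ?cl (mon \<nu>) \<in> h.S.Span (scalars e k) Us"
        using h.S.Span_smult_closed[OF K Us] by blast
      moreover have "?cl (mon \<nu>) = ?cl (mon \<mu>)"
        unfolding truncated_class_eq_iff using \<nu>(2)
        by (intro bexI[of _ 0]) (simp_all add: mon_diff_mem_toric_ideal_iff degree_ge_def)
      moreover have "?cl (const c) \<otimes>\<^bsub>truncated_ring e k\<^esub> ?cl (mon \<mu>) = ?cl (Poly_Mapping.single \<mu> c)"
        using h.hom_mult[of "const c" "mon \<mu>"] by (simp add: const_mult_mon)
      ultimately show ?thesis by simp
    next
      case False
      with that have "Poly_Mapping.single \<mu> c \<in> (degree_ge (Suc k) :: ('n, 'k) mpoly set)"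
        by (auto simp: degree_ge_def)
      moreover have "(0 :: ('n, 'k) mpoly) \<in> toric_ideal e"
        using additive_subgroup.zero_closed[OF ideal.axioms(1)[OF ideal_toric_ideal]] by simp
      ultimately have "?cl (Poly_Mapping.single \<mu> c) = ?cl 0"
        \<comment> \<open>The term itself serves as the summand of high degree, leaving 0 for the
          toric ideal.\<close>
        unfolding truncated_class_eq_iff by (intro bexI[of _ "Poly_Mapping.single \<mu> c"]) simp_all
      then show ?thesis using h.S.Span_subgroup_props(2)[OF K Us] by (simp add: zero del: h.S.Span.simps)
    qed
    have sum: "?cl (\<Sum>\<mu>\<in>A. Poly_Mapping.single \<mu> (c \<mu>)) \<in> h.S.Span (scalars e k) Us"
      if "\<And>\<mu>. \<mu> \<in> A \<Longrightarrow> k \<le> total_deg \<mu>" for A c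
      using that
    proof (induction A rule: infinite_finite_induct)
      case (insert \<mu> A)
      then have "?cl (Poly_Mapping.single \<mu> (c \<mu>)) \<oplus>\<^bsub>truncated_ring e k\<^esub> ?cl (\<Sum>\<mu>\<in>A. Poly_Mapping.single \<mu> (c \<mu>))
          \<in> h.S.Span (scalars e k) Us"
        by (intro h.S.Span_subgroup_props(3)[OF K Us] single insert.IH) auto
      with insert.hyps show ?case
        using h.hom_add[of "Poly_Mapping.single \<mu> (c \<mu>)"] by (simp del: h.S.Span.simps)
    qed (use h.S.Span_subgroup_props(2)[OF K Us] in \<open>simp_all add: zero del: h.S.Span.simps\<close>)
    show "power_quotient e k \<subseteq> h.S.Span (scalars e k) Us"
    proof
      fix x assume "x \<in> (power_quotient e k :: ('n, 'k) mpoly set set set)"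
      then obtain p where "x = ?cl p" "p \<in> degree_ge k" unfolding power_quotient_eq by blast
      then show "x \<in> h.S.Span (scalars e k) Us"
        using sum[of "keys p" "lookup p"] unfolding poly_mapping_eq_sum_single[symmetric]
        by (simp add: degree_ge_def del: h.S.Span.simps)
    qed
  qed
  ultimately show ?thesis unfolding len by (rule h.S.dimensionI[OF K])
qed

end
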